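(* Let $\ell$ and $p$ be distinct primes. Let $X$ be a multigraph (finite, connected, with no vertex of valency one and nonzero Euler characteristic) with vertices $v_1,\dots,v_g$, let $S$ be a choice of one orientation of each undirected edge of $X$, and let $\alpha:S\to\mathbb{Z}_\ell$ be a function such that all derived multigraphs $X_n=X(\mathbb{Z}/\ell^n\mathbb{Z},S,\alpha_n)$, $n\ge 1$, are connected. Let $\kappa_n$ be the number of spanning trees of $X_n$. Let $f(T)=\det M(T)\in\mathbb{Z}[T;\mathbb{Z}_\ell]$, let $\mu=\mu(f(T))$, and write $f(T)=p^{\mu}\cdot g(T)$ with $g(T)\in\mathbb{Z}[T;\mathbb{Z}_\ell]$ and $\mu(g(T))=0$. Let $n_0$ be the minimal positive integer such that $g(\xi)\not\equiv 0\pmod{\mathfrak{m}_\infty}$ for every primitive $\ell^i$-th root of unity $\xi\in\mathbb{Q}_p(\xi_{\ell^\infty})$ with $i\ge n_0$ (such an integer exists). Then there exists an integer $\nu$ such that $$\mathrm{ord}_p(\kappa_n)=\mu\cdot\ell^n+\nu\quad\text{for all } n\ge n_0.$$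
   Context: Multigraphs: $X$ has vertex set $V_X$, undirected edge set $E_X$, and directed edge set $\vec E_X$ (each undirected edge, including each loop, gives two opposite directed edges), with incidence map $\mathrm{inc}:\vec E_X\to V_X\times V_X$ sending a directed edge to (origin, terminus). The Euler characteristic is $|V_X|-|E_X|$. $S\subseteq\vec E_X$ contains exactly one orientation of each undirected edge. For $\alpha:S\to\mathbb{Z}_\ell$, $\alpha_n:S\to\mathbb{Z}/\ell^n\mathbb{Z}$ is its reduction mod $\ell^n$. The derived multigraph $X(\mathbb{Z}/\ell^n\mathbb{Z},S,\alpha_n)$ has vertex set $V_X\times\mathbb{Z}/\ell^n\mathbb{Z}$ and, for each $s\in S$ with $\mathrm{inc}(s)=(v,w)$ and each $\sigma\in\mathbb{Z}/\ell^n\mathbb{Z}$, one edge joining $(v,\sigma)$ and $(w,\sigma+\alpha_n(s))$; these form an abelian $\ell$-tower $X\leftarrow X_1\leftarrow X_2\leftarrow\cdots$. Generalized polynomials: for a commutative ring $R$, $R[T;\mathbb{Z}_\ell]$ is the ring of finite formal sums $\sum_{a\in\mathbb{Z}_\ell}\lambda_aT^a$ ($\lambda_a\in R$, almost all zero) with $T^aT^b=T^{a+b}$. If $\xi$ is an element of a ring receiving a map from $R$ with $\xi^{\ell^m}=1$ for some $m$, then $\xi^a$ is well defined for $a\in\mathbb{Z}_\ell$ and $P(\xi)=\sum\lambda_a\xi^a$. For $P=\sum\lambda_aT^a\in\mathbb{Z}[T;\mathbb{Z}_\ell]$, $\mu(P)=\min_a\mathrm{ord}_p(\lambda_a)$.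 The matrix $M(T)\in M_{g\times g}(\mathbb{Z}[T;\mathbb{Z}_\ell])$ has $(i,j)$ entry $D_{ij}-\Big(\sum_{s\in S,\ \mathrm{inc}(s)=(v_i,v_j)}T^{\alpha(s)}+\sum_{s\in S,\ \mathrm{inc}(s)=(v_j,v_i)}T^{-\alpha(s)}\Big)$, where $D$ is the diagonal valency matrix of $X$ (a loop contributes $2$ to the valency). Local fields: $v_p$ is the valuation on $\overline{\mathbb{Q}}_p$ extending $\mathrm{ord}_p$; $\xi_{\ell^i}\in\overline{\mathbb{Q}}_p$ are compatible primitive $\ell^i$-th roots of unity; $\mathbb{Q}_p(\xi_{\ell^\infty})=\bigcup_i\mathbb{Q}_p(\xi_{\ell^i})$, with valuation ring $O_\infty$, maximal ideal $\mathfrak{m}_\infty$ and residue field $k_\infty=O_\infty/\mathfrak{m}_\infty$. *)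

theory Defs
  imports
    "HOL-Library.Poly_Mapping"
    "HOL-Library.Extended_Nat"
    "HOL-Library.Extended_Real"
    "HOL-Computational_Algebra.Fraction_Field"
    "HOL-Algebra.Generated_Fields"
    "HOL-Algebra.Algebraic_Closure_Type"
    "Jordan_Normal_Form.Determinant"
    "Berlekamp_Zassenhaus.Finite_Field"
begin

section \<open>The ring of p-adic integers\<close>

text \<open>
  The prime is the cardinality of the phantom type parameter. A p-adic integer is a coherent
  sequence in the inverse limit of the rings Z/p^n, where Z/p^n is represented by
  the residues 0, ..., p^n - 1.
\<close>

typedef 'p::prime_card padic_int =
  "{x :: nat \<Rightarrow> int. \<forall>n. x n \<in> {0..<int CARD('p) ^ n} \<and> x (Suc n) mod int CARD('p) ^ n = x n}"
  morphisms padic_red_fun Abs_padic_int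
  by (rule exI[of _ "\<lambda>_. 0"]) (auto simp: prime_card)

definition padic_red :: "nat \<Rightarrow> 'p::prime_card padic_int \<Rightarrow> int" where
  "padic_red n x = padic_red_fun x n"

lemma CARD_prime_pos [simp]: "0 < int CARD('p::prime_card) ^ n"
  by simp

lemma padic_red_range:
  "0 \<le> padic_red n (x :: 'p::prime_card padic_int)"
  "padic_red n (x :: 'p::prime_card padic_int) < int CARD('p) ^ n"
  using padic_red_fun[of x] by (auto simp: padic_red_def)

lemma padic_red_mod_self [simp]:
  "padic_red n (x :: 'p::prime_card padic_int) mod int CARD('p) ^ n = padic_red n x"
  using padic_red_range[where x = x and n = n] by simp

lemma padic_red_Suc_mod:
  "padic_red (Suc n) (x :: 'p::prime_card padic_int) mod int CARD('p) ^ n = padic_red n x"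
  using padic_red_fun[of x] by (auto simp: padic_red_def)

lemma padic_red_mod:
  assumes "m \<le> n"
  shows "padic_red n (x :: 'p::prime_card padic_int) mod int CARD('p) ^ m = padic_red m x"
  using assms
proof (induction n rule: dec_induct)
  case base
  show ?case by simp
next
  case (step n)
  have "padic_red (Suc n) x mod int CARD('p) ^ m
          = padic_red (Suc n) x mod int CARD('p) ^ n mod int CARD('p) ^ m"
    using step by (simp add: mod_mod_cancel le_imp_power_dvd)
  with step show ?case by (simp add: padic_red_Suc_mod)
qed

lemma padic_eqI: "(\<And>n. padic_red n x = padic_red n y) \<Longrightarrow> x = y"
  unfolding padic_red_def by (metis padic_red_fun_inject ext)

text \<open>Coherent sequences obtained by reducing a sequence of integers.\<close>

definition padic_of_seq :: "(nat \<Rightarrow> int) \<Rightarrow> 'p::prime_card padic_int" where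
  "padic_of_seq s = Abs_padic_int (\<lambda>n. s n mod int CARD('p) ^ n)"

lemma padic_red_of_seq:
  assumes "\<And>n. s (Suc n) mod int CARD('p) ^ n = s n mod int CARD('p) ^ n"
  shows "padic_red n (padic_of_seq s :: 'p::prime_card padic_int) = s n mod int CARD('p) ^ n"
proof -
  have "(\<lambda>n. s n mod int CARD('p) ^ n) \<in> {x :: nat \<Rightarrow> int. \<forall>n. x n \<in> {0..<int CARD('p) ^ n} \<and>
          x (Suc n) mod int CARD('p) ^ n = x n}"
    using assms by (auto simp: mod_mod_cancel)
  thus ?thesis
    unfolding padic_red_def padic_of_seq_def by (simp add: Abs_padic_int_inverse)
qed

instantiation padic_int :: (prime_card) comm_ring_1
begin

definition zero_padic_int :: "'a padic_int" where "0 = padic_of_seq (\<lambda>_. 0)"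
definition one_padic_int :: "'a padic_int" where "1 = padic_of_seq (\<lambda>_. 1)"
definition plus_padic_int :: "'a padic_int \<Rightarrow> 'a padic_int \<Rightarrow> 'a padic_int" where
  "x + y = padic_of_seq (\<lambda>n. padic_red n x + padic_red n y)"
definition times_padic_int :: "'a padic_int \<Rightarrow> 'a padic_int \<Rightarrow> 'a padic_int" where
  "x * y = padic_of_seq (\<lambda>n. padic_red n x * padic_red n y)"
definition uminus_padic_int :: "'a padic_int \<Rightarrow> 'a padic_int" where
  "- x = padic_of_seq (\<lambda>n. - padic_red n x)"
definition minus_padic_int :: "'a padic_int \<Rightarrow> 'a padic_int \<Rightarrow> 'a padic_int" where
  "x - y = padic_of_seq (\<lambda>n. padic_red n x - padic_red n y)"

lemma padic_red_0: "padic_red n (0 :: 'a padic_int) = 0"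
  unfolding zero_padic_int_def by (subst padic_red_of_seq) auto

lemma padic_red_1: "padic_red n (1 :: 'a padic_int) = 1 mod int CARD('a) ^ n"
  unfolding one_padic_int_def by (subst padic_red_of_seq) auto

lemma padic_red_add:
  "padic_red n (x + y :: 'a padic_int) = (padic_red n x + padic_red n y) mod int CARD('a) ^ n"
  unfolding plus_padic_int_def
  by (subst padic_red_of_seq) (auto intro!: mod_add_cong simp: padic_red_Suc_mod)

lemma padic_red_mult:
  "padic_red n (x * y :: 'a padic_int) = (padic_red n x * padic_red n y) mod int CARD('a) ^ n"
  unfolding times_padic_int_def
  by (subst padic_red_of_seq) (auto intro!: mod_mult_cong simp: padic_red_Suc_mod)

lemma padic_red_uminus:
  "padic_red n (- x :: 'a padic_int) = (- padic_red n x) mod int CARD('a) ^ n"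
  unfolding uminus_padic_int_def
  by (subst padic_red_of_seq) (auto intro!: mod_minus_cong simp: padic_red_Suc_mod)

lemma padic_red_diff:
  "padic_red n (x - y :: 'a padic_int) = (padic_red n x - padic_red n y) mod int CARD('a) ^ n"
  unfolding minus_padic_int_def
  by (subst padic_red_of_seq) (auto intro!: mod_diff_cong simp: padic_red_Suc_mod)

instance
proof
  fix a b c :: "'a padic_int"
  note r = padic_red_0 padic_red_1 padic_red_add padic_red_mult padic_red_uminus padic_red_diff
  show "a * b * c = a * (b * c)"
    by (rule padic_eqI) (simp add: r mod_simps mult.assoc)
  show "a * b = b * a"
    by (rule padic_eqI) (simp add: r mult.commute)
  show "1 * a = a"
    by (rule padic_eqI) (simp add: r mod_simps)
  show "a + b + c = a + (b + c)"
    by (rule padic_eqI) (simp add: r mod_simps add.assoc)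
  show "a + b = b + a"
    by (rule padic_eqI) (simp add: r add.commute)
  show "0 + a = a"
    by (rule padic_eqI) (simp add: r)
  show "- a + a = 0"
    by (rule padic_eqI) (simp add: r mod_simps)
  show "a - b = a + - b"
    by (rule padic_eqI) (simp add: r mod_simps)
  show "(a + b) * c = a * c + b * c"
    by (rule padic_eqI) (simp add: r mod_simps distrib_right)
  have "padic_red 1 (1 :: 'a padic_int) \<noteq> padic_red 1 0"
    using prime_gt_1_nat[OF prime_card[where 'a = 'a]] by (simp add: r)
  thus "(0 :: 'a padic_int) \<noteq> 1" by metis
qed

end

lemma padic_red_of_nat:
  "padic_red n (of_nat k :: 'p::prime_card padic_int) = int k mod int CARD('p) ^ n"
  by (induction k) (simp_all add: padic_red_0 padic_red_1 padic_red_add mod_simps)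

lemma padic_red_mult_eq_0:
  fixes x y :: "'p::prime_card padic_int"
  assumes "padic_red (m + n) (x * y) = 0"
  shows "padic_red m x = 0 \<or> padic_red n y = 0"
proof -
  let ?p = "int CARD('p)"
  have p: "prime ?p" using prime_card[where 'a = 'p] by simp
  have "?p ^ (m + n) dvd padic_red (m + n) x * padic_red (m + n) y"
    using assms by (simp add: padic_red_mult mod_eq_0_iff_dvd)
  hence "?p ^ m dvd padic_red (m + n) x \<or> ?p ^ n dvd padic_red (m + n) y"
  proof (cases "padic_red (m + n) x = 0 \<or> padic_red (m + n) y = 0")
    case False
    hence "m + n \<le> multiplicity ?p (padic_red (m + n) x) + multiplicity ?p (padic_red (m + n) y)"
      using p \<open>?p ^ (m + n) dvd _\<close>
      by (subst (asm) power_dvd_iff_le_multiplicity)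
         (auto simp: prime_elem_multiplicity_mult_distrib)
    hence "m \<le> multiplicity ?p (padic_red (m + n) x) \<or> n \<le> multiplicity ?p (padic_red (m + n) y)"
      by linarith
    thus ?thesis by (auto intro: multiplicity_dvd')
  qed auto
  thus ?thesis
    by (metis dvd_imp_mod_0 le_add1 le_add2 padic_red_mod)
qed

instance padic_int :: (prime_card) idom
proof
  fix x y :: "'a padic_int"
  assume "x \<noteq> 0" "y \<noteq> 0"
  then obtain m n where "padic_red m x \<noteq> 0" "padic_red n y \<noteq> 0"
    by (metis padic_eqI padic_red_0)
  hence "padic_red (m + n) (x * y) \<noteq> 0" using padic_red_mult_eq_0 by blast
  thus "x * y \<noteq> 0" by (metis padic_red_0)
qed


lemma padic_power_dvd_iff:
  "of_nat (CARD('p)) ^ n dvd (x :: 'p::prime_card padic_int) \<longleftrightarrow> padic_red n x = 0"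
proof
  assume "of_nat (CARD('p)) ^ n dvd x"
  then obtain y where "x = of_nat (CARD('p) ^ n) * y" by (auto simp: dvd_def)
  thus "padic_red n x = 0" by (simp add: padic_red_mult padic_red_of_nat del: of_nat_power) simp
next
  assume n: "padic_red n x = 0"
  let ?q = "int CARD('p)"
  define y :: "'p padic_int" where "y = padic_of_seq (\<lambda>k. padic_red (n + k) x div ?q ^ n)"
  have dv: "?q ^ n dvd padic_red (n + k) x" for k
    using padic_red_mod[of n "n + k" x] n by (simp add: mod_eq_0_iff_dvd)
  have y: "padic_red k y = (padic_red (n + k) x div ?q ^ n) mod ?q ^ k" for k
    unfolding y_def
  proof (rule padic_red_of_seq)
    fix k
    have "padic_red (n + Suc k) x div ?q ^ n mod ?q ^ k = padic_red (n + Suc k) x mod ?q ^ (n + k) div ?q ^ n"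
      by (simp add: power_add zmod_zmult2_eq)
    also have "\<dots> = padic_red (n + k) x div ?q ^ n" by (simp add: padic_red_mod)
    finally show "padic_red (n + Suc k) x div ?q ^ n mod ?q ^ k = padic_red (n + k) x div ?q ^ n mod ?q ^ k"
      by (metis mod_mod_trivial)
  qed
  have "x = of_nat (CARD('p) ^ n) * y"
  proof (rule padic_eqI)
    fix k
    have "padic_red k (of_nat (CARD('p) ^ n) * y) = (?q ^ n * (padic_red (n + k) x div ?q ^ n)) mod ?q ^ k"
      by (simp add: padic_red_mult padic_red_of_nat y mod_simps del: of_nat_power) (simp)
    also have "\<dots> = padic_red (n + k) x mod ?q ^ k" using dv[of k] by simp
    also have "\<dots> = padic_red k x" by (simp add: padic_red_mod)
    finally show "padic_red k x = padic_red k (of_nat (CARD('p) ^ n) * y)" ..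
  qed
  thus "of_nat (CARD('p)) ^ n dvd x" by (metis dvd_triv_left of_nat_power)
qed

definition padic_int_ord :: "'p::prime_card padic_int \<Rightarrow> nat" where
  "padic_int_ord x = (GREATEST n. of_nat (CARD('p)) ^ n dvd x)"

lemma padic_power_dvd_iff_le_ord:
  assumes "x \<noteq> 0"
  shows "of_nat (CARD('p)) ^ n dvd (x :: 'p::prime_card padic_int) \<longleftrightarrow> n \<le> padic_int_ord x"
proof -
  let ?q = "of_nat (CARD('p)) :: 'p padic_int"
  obtain N where N: "padic_red N x \<noteq> 0" using assms by (metis padic_eqI padic_red_0)
  have bd: "n \<le> N" if "?q ^ n dvd x" for n
    using that N by (metis dvd_trans le_imp_power_dvd linorder_le_cases padic_power_dvd_iff)
  have "?q ^ padic_int_ord x dvd x"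
    unfolding padic_int_ord_def by (rule GreatestI_nat[of _ 0 N]) (auto dest: bd)
  moreover have "n \<le> padic_int_ord x" if "?q ^ n dvd x" for n
    unfolding padic_int_ord_def using that by (rule Greatest_le_nat[of _ _ N]) (auto dest: bd)
  ultimately show ?thesis by (meson dvd_trans le_imp_power_dvd)
qed

lemma padic_int_ord_mult:
  fixes x y :: "'p::prime_card padic_int"
  assumes "x \<noteq> 0" "y \<noteq> 0"
  shows "padic_int_ord (x * y) = padic_int_ord x + padic_int_ord y"
proof (rule antisym)
  let ?q = "of_nat (CARD('p)) :: 'p padic_int"
  have "?q ^ (padic_int_ord x + padic_int_ord y) dvd x * y"
    unfolding power_add using assms by (intro mult_dvd_mono) (simp_all add: padic_power_dvd_iff_le_ord)
  thus "padic_int_ord x + padic_int_ord y \<le> padic_int_ord (x * y)"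
    using assms by (simp add: padic_power_dvd_iff_le_ord)
  obtain x' y' where x': "x = ?q ^ padic_int_ord x * x'" and y': "y = ?q ^ padic_int_ord y * y'"
    using assms padic_power_dvd_iff_le_ord by (metis dvdE order_refl)
  have nd: "padic_red 1 x' \<noteq> 0" "padic_red 1 y' \<noteq> 0"
  proof -
    have "\<not> ?q dvd x'" "\<not> ?q dvd y'"
      using assms x' y' padic_power_dvd_iff_le_ord[of x "Suc (padic_int_ord x)"]
        padic_power_dvd_iff_le_ord[of y "Suc (padic_int_ord y)"]
      by (metis Suc_n_not_le_n mult_dvd_mono dvd_refl power_Suc2)+
    thus "padic_red 1 x' \<noteq> 0" "padic_red 1 y' \<noteq> 0"
      using padic_power_dvd_iff[of 1] by (metis power_one_right)+
  qed
  have "\<not> ?q dvd x' * y'"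
  proof
    assume "?q dvd x' * y'"
    hence "padic_red 1 (x' * y') = 0" using padic_power_dvd_iff[of 1] by (metis power_one_right)
    hence "int CARD('p) dvd padic_red 1 x' * padic_red 1 y'"
      by (simp add: padic_red_mult mod_eq_0_iff_dvd)
    moreover have "prime (int CARD('p))" using prime_card[where 'a = 'p] by simp
    ultimately have "int CARD('p) dvd padic_red 1 x' \<or> int CARD('p) dvd padic_red 1 y'"
      by (simp add: prime_dvd_mult_iff)
    thus False
      using nd padic_red_mod_self[of 1 x'] padic_red_mod_self[of 1 y']
      by (metis dvd_imp_mod_0 power_one_right)
  qed
  moreover have "x * y = ?q ^ (padic_int_ord x + padic_int_ord y) * (x' * y')"
    by (subst x', subst y') (simp add: power_add algebra_simps)
  moreover have "?q ^ (padic_int_ord x + padic_int_ord y) \<noteq> 0"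
    using assms x' y' by (metis mult_eq_0_iff power_add)
  ultimately have "\<not> ?q ^ Suc (padic_int_ord x + padic_int_ord y) dvd x * y"
    unfolding power_Suc2 by (metis dvd_mult_cancel_left)
  thus "padic_int_ord (x * y) \<le> padic_int_ord x + padic_int_ord y"
    using assms by (subst (asm) padic_power_dvd_iff_le_ord) auto
qed


section \<open>The field of p-adic numbers, its algebraic closure and valuation\<close>

type_synonym 'p padic = "'p padic_int fract"

type_synonym 'p padic_ac = "'p padic alg_closure"

definition padic_ord :: "'p::prime_card padic \<Rightarrow> ereal" where
  "padic_ord x = (if x = 0 then \<infinity> else
     (THE r. \<exists>a b. a \<noteq> 0 \<and> b \<noteq> 0 \<and> x = Fract a b \<and>
        r = ereal (real (padic_int_ord a) - real (padic_int_ord b))))"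

lemma padic_ord_Fract:
  fixes a b :: "'p::prime_card padic_int"
  assumes "a \<noteq> 0" "b \<noteq> 0"
  shows "padic_ord (Fract a b) = ereal (real (padic_int_ord a) - real (padic_int_ord b))"
proof -
  have "(THE r. \<exists>c d. c \<noteq> 0 \<and> d \<noteq> 0 \<and> Fract a b = Fract c d \<and>
        r = ereal (real (padic_int_ord c) - real (padic_int_ord d)))
        = ereal (real (padic_int_ord a) - real (padic_int_ord b))"
  proof (rule the_equality)
    fix r
    assume "\<exists>c d. c \<noteq> 0 \<and> d \<noteq> 0 \<and> Fract a b = Fract c d \<and>
        r = ereal (real (padic_int_ord c) - real (padic_int_ord d))"
    then obtain c d where cd: "c \<noteq> 0" "d \<noteq> 0" "Fract a b = Fract c d"
      and r: "r = ereal (real (padic_int_ord c) - real (padic_int_ord d))" by blast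
    have "a * d = c * b" using cd assms by (simp add: eq_fract)
    hence "padic_int_ord a + padic_int_ord d = padic_int_ord c + padic_int_ord b"
      using cd assms by (metis padic_int_ord_mult)
    thus "r = ereal (real (padic_int_ord a) - real (padic_int_ord b))"
      unfolding r by simp
  qed (use assms in blast)
  moreover have "Fract a b \<noteq> 0" using assms by (simp add: Zero_fract_def eq_fract)
  ultimately show ?thesis by (simp add: padic_ord_def)
qed

text \<open>
  Valuations are written additively, with value \<open>\<infinity>\<close> exactly at 0. Exactly one valuation on the
  algebraic closure of the p-adic numbers extends \<open>padic_ord\<close>.
\<close>

definition valuation :: "('a::Fields.field \<Rightarrow> ereal) \<Rightarrow> bool" where
  "valuation v \<longleftrightarrow>
     (\<forall>x. v x = \<infinity> \<longleftrightarrow> x = 0) \<and> (\<forall>x. v x \<noteq> -\<infinity>) \<and>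
     (\<forall>x y. v (x * y) = v x + v y) \<and> (\<forall>x y. min (v x) (v y) \<le> v (x + y))"

definition extends_padic_ord :: "('p::prime_card padic_ac \<Rightarrow> ereal) \<Rightarrow> bool" where
  "extends_padic_ord v \<longleftrightarrow> (\<forall>x. v (to_ac x) = padic_ord x)"

definition primitive_root_of_unity :: "nat \<Rightarrow> 'a::monoid_mult \<Rightarrow> bool" where
  "primitive_root_of_unity N \<xi> \<longleftrightarrow> \<xi> ^ N = 1 \<and> (\<forall>k. 0 < k \<and> k < N \<longrightarrow> \<xi> ^ k \<noteq> 1)"

definition compatible_primitive_roots :: "nat \<Rightarrow> (nat \<Rightarrow> 'a::monoid_mult) \<Rightarrow> bool" where
  "compatible_primitive_roots l \<zeta> \<longleftrightarrow>
     (\<forall>i. primitive_root_of_unity (l ^ i) (\<zeta> i) \<and> \<zeta> (Suc i) ^ l = \<zeta> i)"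

definition padic_adjoin :: "'p::prime_card padic_ac \<Rightarrow> 'p padic_ac set" where
  "padic_adjoin \<xi> = generate_field ring_of_type_algebra (range to_ac \<union> {\<xi>})"

definition padic_cyclotomic_union :: "(nat \<Rightarrow> 'p::prime_card padic_ac) \<Rightarrow> 'p padic_ac set" where
  "padic_cyclotomic_union \<zeta> = (\<Union>i. padic_adjoin (\<zeta> i))"

text \<open>The maximal ideal of the valuation ring of v restricted to the subfield K.\<close>

definition maximal_ideal_on :: "('a \<Rightarrow> ereal) \<Rightarrow> 'a set \<Rightarrow> 'a set" where
  "maximal_ideal_on v K = {x \<in> K. 0 < v x}"


section \<open>Generalized polynomials\<close>

text \<open>
  The ring of finite formal sums of terms \<open>c T\<^sup>a\<close> with \<open>a\<close> an \<open>l\<close>-adic integer is the monoid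
  algebra of the additive group of \<open>l\<close>-adic integers, whose product is that of
  \<^typ>\<open>'a \<Rightarrow>\<^sub>0 'b\<close>.
\<close>

type_synonym ('l, 'r) gen_poly = "'l padic_int \<Rightarrow>\<^sub>0 'r"

definition gp_T_pow :: "'l::prime_card padic_int \<Rightarrow> ('l, 'r::comm_ring_1) gen_poly" where
  "gp_T_pow a = Poly_Mapping.single a 1"

lemma gp_T_pow_add: "gp_T_pow a * gp_T_pow b = gp_T_pow (a + b)"
  by (simp add: gp_T_pow_def Poly_Mapping.mult_single)

definition padic_power :: "'a::monoid_mult \<Rightarrow> 'l::prime_card padic_int \<Rightarrow> 'a" where
  "padic_power \<xi> a = \<xi> ^ nat (padic_red (LEAST m. \<xi> ^ (CARD('l) ^ m) = 1) a)"

lemma padic_power_eq: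
  fixes a :: "'l::prime_card padic_int" and \<xi> :: "'a::monoid_mult"
  assumes "\<xi> ^ (CARD('l) ^ m) = 1"
  shows "padic_power \<xi> a = \<xi> ^ nat (padic_red m a)"
proof -
  define k where "k = (LEAST m. \<xi> ^ (CARD('l) ^ m) = 1)"
  have k: "\<xi> ^ (CARD('l) ^ k) = 1" unfolding k_def using assms by (rule LeastI)
  have "k \<le> m" unfolding k_def using assms by (rule Least_le)
  hence "padic_red k a = padic_red m a mod int CARD('l) ^ k" by (simp add: padic_red_mod)
  hence "nat (padic_red k a) = nat (padic_red m a) mod CARD('l) ^ k"
    using padic_red_range(1)[of m a] by (simp add: nat_mod_distrib nat_power_eq)
  moreover have "\<xi> ^ (n mod CARD('l) ^ k) = \<xi> ^ n" for n
  proof -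
    have "\<xi> ^ n = \<xi> ^ (CARD('l) ^ k * (n div CARD('l) ^ k) + n mod CARD('l) ^ k)" by simp
    also have "\<dots> = \<xi> ^ (n mod CARD('l) ^ k)" unfolding power_add power_mult k by simp
    finally show ?thesis ..
  qed
  ultimately show ?thesis unfolding padic_power_def k_def[symmetric] by simp
qed

definition gp_eval :: "('l::prime_card, int) gen_poly \<Rightarrow> 'a::comm_ring_1 \<Rightarrow> 'a" where
  "gp_eval P \<xi> = (\<Sum>a\<in>Poly_Mapping.keys P. of_int (Poly_Mapping.lookup P a) * padic_power \<xi> a)"

definition int_ord :: "nat \<Rightarrow> int \<Rightarrow> enat" where
  "int_ord p c = (if c = 0 then \<infinity> else enat (multiplicity (int p) c))"

definition gp_mu :: "nat \<Rightarrow> ('l::prime_card, int) gen_poly \<Rightarrow> enat" where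
  "gp_mu p P = (INF a. int_ord p (Poly_Mapping.lookup P a))"


section \<open>Multigraphs\<close>

text \<open>
  Multigraphs are given by their directed edges together with the orientation-reversing map
  \<open>opp\<close>; an undirected edge is a pair of opposite directed edges.
\<close>

record ('v, 'e) multigraph =
  verts :: "'v set"
  darts :: "'e set"
  inc :: "'e \<Rightarrow> 'v \<times> 'v"
  opp :: "'e \<Rightarrow> 'e"

definition is_multigraph :: "('v, 'e) multigraph \<Rightarrow> bool" where
  "is_multigraph G \<longleftrightarrow>
     (\<forall>e\<in>darts G. inc G e \<in> verts G \<times> verts G \<and> opp G e \<in> darts G \<and> opp G e \<noteq> e \<and>
        opp G (opp G e) = e \<and> inc G (opp G e) = prod.swap (inc G e))"

definition finite_multigraph :: "('v, 'e) multigraph \<Rightarrow> bool" where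
  "finite_multigraph G \<longleftrightarrow> is_multigraph G \<and> finite (verts G) \<and> finite (darts G)"

definition uedge :: "('v, 'e) multigraph \<Rightarrow> 'e \<Rightarrow> 'e set" where
  "uedge G e = {e, opp G e}"

definition uedges :: "('v, 'e) multigraph \<Rightarrow> 'e set set" where
  "uedges G = uedge G ` darts G"

definition euler_char :: "('v, 'e) multigraph \<Rightarrow> int" where
  "euler_char G = int (card (verts G)) - int (card (uedges G))"

text \<open>A loop has two orientations, so it contributes 2.\<close>

definition valency :: "('v, 'e) multigraph \<Rightarrow> 'v \<Rightarrow> nat" where
  "valency G v = card {e \<in> darts G. fst (inc G e) = v}"

definition connected_multigraph :: "('v, 'e) multigraph \<Rightarrow> bool" where
  "connected_multigraph G \<longleftrightarrow>
     verts G \<noteq> {} \<and> (\<forall>u\<in>verts G. \<forall>w\<in>verts G. (u, w) \<in> (inc G ` darts G)\<^sup>*)"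

text \<open>
  A cycle of length 1 is a loop; a cycle of length 2 uses two distinct parallel edges, which is
  why distinctness of the undirected edges is required as well.
\<close>

definition is_cycle :: "('v, 'e) multigraph \<Rightarrow> 'e list \<Rightarrow> bool" where
  "is_cycle G es \<longleftrightarrow>
     es \<noteq> [] \<and> set es \<subseteq> darts G \<and>
     (\<forall>i<length es. snd (inc G (es ! i)) = fst (inc G (es ! (Suc i mod length es)))) \<and>
     distinct (map (\<lambda>e. fst (inc G e)) es) \<and> distinct (map (uedge G) es)"

definition is_tree :: "('v, 'e) multigraph \<Rightarrow> bool" where
  "is_tree G \<longleftrightarrow> connected_multigraph G \<and> (\<nexists>es. is_cycle G es)"

definition spanning_trees :: "('v, 'e) multigraph \<Rightarrow> 'e set set set" where
  "spanning_trees G = {F. F \<subseteq> uedges G \<and> is_tree (G\<lparr>darts := \<Union>F\<rparr>)}"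

definition is_orientation :: "('v, 'e) multigraph \<Rightarrow> 'e set \<Rightarrow> bool" where
  "is_orientation G S \<longleftrightarrow> S \<subseteq> darts G \<and> (\<forall>E\<in>uedges G. \<exists>!s. s \<in> S \<and> s \<in> E)"

text \<open>
  The derived multigraph for the group Z/mZ (represented by the residues 0, ..., m - 1):
  the undirected edge indexed by \<open>(s, \<sigma>)\<close> has the two orientations \<open>(s, \<sigma>, True)\<close> and
  \<open>(s, \<sigma>, False)\<close>.
\<close>

definition derived_multigraph ::
  "('v, 'e) multigraph \<Rightarrow> int \<Rightarrow> 'e set \<Rightarrow> ('e \<Rightarrow> int) \<Rightarrow> ('v \<times> int, 'e \<times> int \<times> bool) multigraph" where
  "derived_multigraph G m S \<beta> =
     \<lparr>verts = verts G \<times> {0..<m},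
      darts = S \<times> {0..<m} \<times> UNIV,
      inc = (\<lambda>(s, \<sigma>, b).
        let d = ((fst (inc G s), \<sigma>), (snd (inc G s), (\<sigma> + \<beta> s) mod m))
        in if b then d else prod.swap d),
      opp = (\<lambda>(s, \<sigma>, b). (s, \<sigma>, \<not> b))\<rparr>"

lemma finite_multigraph_derived:
  assumes "finite_multigraph G" "S \<subseteq> darts G" "0 < m"
  shows "finite_multigraph (derived_multigraph G m S \<beta>)"
  using assms unfolding finite_multigraph_def is_multigraph_def derived_multigraph_def
  by (auto simp: Let_def mem_Times_iff intro!: finite_cartesian_product intro: finite_subset)

definition tower_layer ::
  "('v, 'e) multigraph \<Rightarrow> 'e set \<Rightarrow> ('e \<Rightarrow> 'l::prime_card padic_int) \<Rightarrow> nat \<Rightarrow>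
     ('v \<times> int, 'e \<times> int \<times> bool) multigraph" where
  "tower_layer G S \<alpha> n =
     derived_multigraph G (int CARD('l) ^ n) S (\<lambda>s. padic_red n (\<alpha> s))"

text \<open>Rows and columns are indexed by the enumeration \<open>vs\<close> of the vertices.\<close>

definition voltage_matrix ::
  "('v, 'e) multigraph \<Rightarrow> 'v list \<Rightarrow> 'e set \<Rightarrow> ('e \<Rightarrow> 'l::prime_card padic_int) \<Rightarrow>
     ('l, int) gen_poly mat" where
  "voltage_matrix G vs S \<alpha> = mat (length vs) (length vs) (\<lambda>(i, j).
     (if i = j then of_nat (valency G (vs ! i)) else 0) -
     ((\<Sum>s\<in>{s \<in> S. inc G s = (vs ! i, vs ! j)}. gp_T_pow (\<alpha> s)) +
      (\<Sum>s\<in>{s \<in> S. inc G s = (vs ! j, vs ! i)}. gp_T_pow (- \<alpha> s))))"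

end

theory Submission
  imports Defs "Jordan_Normal_Form.Char_Poly" "HOL-Number_Theory.Pocklington"
begin

text \<open>
  By the matrix-tree theorem the number of spanning trees of \<open>X\<^sub>n\<close> is, up to the number of vertices
  and a sign, the linear coefficient of the characteristic polynomial of its Laplacian. The discrete
  Fourier transform over \<open>\<int>/l\<^sup>n\<close> block-diagonalises this Laplacian into the matrices \<open>M(\<xi>)\<close> with
  \<open>\<xi>\<close> running over the \<open>l\<^sup>n\<close>-th roots of unity, so that \<open>l\<^sup>n \<kappa>\<^sub>n\<close> is \<open>\<kappa>\<^sub>0\<close> times the product of the
  \<open>f(\<xi>)\<close> over \<open>\<xi> \<noteq> 1\<close>. Passing from \<open>n\<close> to \<open>n + 1\<close> adds one factor for each primitive
  \<open>l\<^sup>n\<^sup>+\<^sup>1\<close>-th root of unity, and each of them has valuation exactly \<open>\<mu>\<close> once \<open>g(\<xi>)\<close> is a unit.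

  That \<open>g(\<xi>)\<close> is a unit for all \<open>\<xi>\<close> of large order follows from the Frobenius congruence
  \<open>g(\<xi>)\<^sup>p \<equiv> g(\<xi>\<^sup>p)\<close>: if \<open>g(\<xi>)\<close> vanishes in the residue field, then so does \<open>g(\<xi>\<^sup>u)\<close> for every \<open>u\<close>
  in the subgroup generated by \<open>p\<close>, which contains all \<open>u \<equiv> 1\<close> modulo a fixed power of \<open>l\<close>; summing
  over these \<open>u\<close> against \<open>\<xi>\<^sup>-\<^sup>u\<^sup>b\<close> isolates the coefficient of \<open>T\<^sup>b\<close>, which is then divisible
  by \<open>p\<close>.
\<close>

section \<open>Walks and cycles\<close>

abbreviation origin :: "('v, 'e) multigraph \<Rightarrow> 'e \<Rightarrow> 'v" where
  "origin G e \<equiv> fst (inc G e)"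

abbreviation terminus :: "('v, 'e) multigraph \<Rightarrow> 'e \<Rightarrow> 'v" where
  "terminus G e \<equiv> snd (inc G e)"

abbreviation out_darts :: "('v, 'e) multigraph \<Rightarrow> 'v \<Rightarrow> 'e set" where
  "out_darts G v \<equiv> {e \<in> darts G. origin G e = v}"

fun walk :: "('v, 'e) multigraph \<Rightarrow> 'v \<Rightarrow> 'e list \<Rightarrow> 'v \<Rightarrow> bool" where
  "walk G u [] w \<longleftrightarrow> u = w"
| "walk G u (e # es) w \<longleftrightarrow> origin G e = u \<and> walk G (terminus G e) es w"

definition simple_walk :: "('v, 'e) multigraph \<Rightarrow> 'v \<Rightarrow> 'e list \<Rightarrow> 'v \<Rightarrow> bool" where
  "simple_walk G u es w \<longleftrightarrow> walk G u es w \<and> distinct (map (origin G) es @ [w])"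

lemma walk_append:
  "walk G u (es @ es') w \<longleftrightarrow> (\<exists>x. walk G u es x \<and> walk G x es' w)"
  by (induction es arbitrary: u) auto

lemma walk_terminus_nth:
  "walk G u es w \<Longrightarrow> i < length es \<Longrightarrow> terminus G (es ! i) = (map (origin G) es @ [w]) ! Suc i"
proof (induction es arbitrary: u i)
  case (Cons e es)
  show ?case
  proof (cases i)
    case 0
    with Cons.prems show ?thesis by (cases es) auto
  next
    case (Suc j)
    with Cons show ?thesis by auto
  qed
qed simp

lemma simple_walk_exists:
  assumes "(u, w) \<in> (inc G ` D)\<^sup>*"
  shows "\<exists>es. simple_walk G u es w \<and> set es \<subseteq> D"
  using assms
proof (induction rule: converse_rtrancl_induct)
  case base
  have "simple_walk G w [] w" by (simp add: simple_walk_def)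
  thus ?case by (intro exI[of _ "[]"]) simp
next
  case (step u y)
  then obtain e es where e: "e \<in> D" "inc G e = (u, y)" and es: "simple_walk G y es w" "set es \<subseteq> D"
    by auto
  consider "u = w" | "u \<in> origin G ` set es" | "u \<noteq> w" "u \<notin> origin G ` set es" by blast
  thus ?case
  proof cases
    case 1
    thus ?thesis by (intro exI[of _ "[]"]) (simp add: simple_walk_def)
  next
    case 2
    then obtain d xs ys where "es = xs @ d # ys" "origin G d = u" by (auto dest: split_list)
    with es show ?thesis
      by (intro exI[of _ "d # ys"]) (auto simp: simple_walk_def walk_append)
  next
    case 3
    with e es show ?thesis by (intro exI[of _ "e # es"]) (auto simp: simple_walk_def)
  qed
qed

lemma is_cycle_predecessor:
  assumes "is_cycle G es" and "e \<in> set es"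
  obtains d where "d \<in> set es" "terminus G d = origin G e"
proof -
  let ?n = "length es"
  obtain i where i: "i < ?n" "es ! i = e" using assms(2) by (auto simp: in_set_conv_nth)
  define j where "j = (if i = 0 then ?n - 1 else i - 1)"
  have j: "j < ?n" "Suc j mod ?n = i" using i(1) by (auto simp: j_def)
  hence "terminus G (es ! j) = origin G e" using assms(1) i(2) by (simp add: is_cycle_def)
  with j(1) show thesis using that[of "es ! j"] by simp
qed

lemma is_cycle_successor:
  assumes "is_cycle G es" and "e \<in> set es"
  obtains d where "d \<in> set es" "origin G d = terminus G e"
proof -
  obtain i where i: "i < length es" "es ! i = e" using assms(2) by (auto simp: in_set_conv_nth)
  hence "origin G (es ! (Suc i mod length es)) = terminus G e"
    using assms(1) by (auto simp: is_cycle_def)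
  moreover have "Suc i mod length es < length es" using i(1) by (intro mod_less_divisor) auto
  ultimately show thesis using that nth_mem by blast
qed

lemma is_cycle_restrict_darts:
  "D \<subseteq> darts G \<Longrightarrow> is_cycle (G\<lparr>darts := D\<rparr>) es \<longleftrightarrow> is_cycle G es \<and> set es \<subseteq> D"
  by (auto simp: is_cycle_def uedge_def[abs_def])

lemma uedge_eqD: "uedge G e = uedge G e' \<Longrightarrow> e = e' \<or> e = opp G e'"
  unfolding uedge_def by blast

locale fin_multigraph =
  fixes G :: "('v, 'e) multigraph"
  assumes finite_G: "finite_multigraph G"
begin

lemma finite_verts: "finite (verts G)" and finite_darts: "finite (darts G)"
  using finite_G by (simp_all add: finite_multigraph_def)

lemma
  assumes "e \<in> darts G"
  shows origin_in_verts: "origin G e \<in> verts G" and terminus_in_verts: "terminus G e \<in> verts G"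
    and opp_in_darts: "opp G e \<in> darts G" and opp_neq: "opp G e \<noteq> e"
    and opp_opp: "opp G (opp G e) = e" and inc_opp: "inc G (opp G e) = prod.swap (inc G e)"
proof -
  have "inc G e \<in> verts G \<times> verts G \<and> opp G e \<in> darts G \<and> opp G e \<noteq> e \<and>
      opp G (opp G e) = e \<and> inc G (opp G e) = prod.swap (inc G e)"
    using finite_G assms unfolding finite_multigraph_def is_multigraph_def by blast
  thus "origin G e \<in> verts G" "terminus G e \<in> verts G" "opp G e \<in> darts G"
    "opp G e \<noteq> e" "opp G (opp G e) = e" "inc G (opp G e) = prod.swap (inc G e)"
    by (auto simp: mem_Times_iff)
qed

lemma uedge_opp: "e \<in> darts G \<Longrightarrow> uedge G (opp G e) = uedge G e"
  unfolding uedge_def by (simp add: opp_opp insert_commute)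

lemma Union_uedges_subset: "F \<subseteq> uedges G \<Longrightarrow> \<Union> F \<subseteq> darts G"
  using opp_in_darts unfolding uedges_def uedge_def by blast

lemma uedge_of_mem:
  assumes "F \<subseteq> uedges G" "E \<in> F" "e \<in> E"
  shows "uedge G e = E"
proof -
  obtain d where "d \<in> darts G" "E = uedge G d" using assms by (auto simp: uedges_def)
  with assms(3) uedge_opp[of d] show ?thesis by (auto simp: uedge_def)
qed

lemma sym_inc_image_Union:
  assumes "F \<subseteq> uedges G"
  shows "sym (inc G ` \<Union> F)"
proof (rule symI)
  fix u w assume "(u, w) \<in> inc G ` \<Union> F"
  then obtain e E where e: "E \<in> F" "e \<in> E" "inc G e = (u, w)" by auto
  hence "opp G e \<in> E" using uedge_of_mem[OF assms] by (auto simp: uedge_def)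
  moreover have "inc G (opp G e) = (w, u)"
    using inc_opp[of e] e Union_uedges_subset[OF assms] by auto
  ultimately show "(w, u) \<in> inc G ` \<Union> F" using e(1) by force
qed

lemma simple_walk_distinct_uedges:
  assumes "simple_walk G u es w" and "set es \<subseteq> darts G"
  shows "distinct (map (uedge G) es)"
  unfolding distinct_conv_nth length_map
proof (intro allI impI notI)
  fix i j assume ij: "i < length es" "j < length es" "i \<noteq> j"
    and "map (uedge G) es ! i = map (uedge G) es ! j"
  hence "uedge G (es ! i) = uedge G (es ! j)" by simp
  let ?vs = "map (origin G) es @ [w]"
  have distinct: "distinct ?vs" and walk: "walk G u es w"
    using assms(1) by (auto simp: simple_walk_def)
  have origin: "origin G (es ! k) = ?vs ! k" if "k < length es" for k
    using that by (simp add: nth_append)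
  from uedge_eqD[OF \<open>uedge G (es ! i) = uedge G (es ! j)\<close>] show False
  proof
    assume "es ! i = es ! j"
    hence "?vs ! i = ?vs ! j" using origin ij by metis
    thus False using distinct ij by (simp add: nth_eq_iff_index_eq del: distinct_append)
  next
    assume opp: "es ! i = opp G (es ! j)"
    have "inc G (es ! i) = prod.swap (inc G (es ! j))"
      unfolding opp using ij assms(2) by (intro inc_opp) auto
    hence "?vs ! i = ?vs ! Suc j" "?vs ! Suc i = ?vs ! j"
      using origin walk_terminus_nth[OF walk] ij by (metis fst_swap snd_swap)+
    hence "i = Suc j" "Suc i = j"
      using distinct ij by (simp_all add: nth_eq_iff_index_eq del: distinct_append)
    thus False by simp
  qed
qed

lemma is_cycle_Cons:
  assumes es: "simple_walk G (terminus G e) es (origin G e)" "set es \<subseteq> darts G"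
    and e: "e \<in> darts G" "uedge G e \<notin> uedge G ` set es"
  shows "is_cycle G (e # es)"
  unfolding is_cycle_def
proof (intro conjI)
  show "distinct (map (origin G) (e # es))" using es(1) by (auto simp: simple_walk_def)
  show "distinct (map (uedge G) (e # es))" using simple_walk_distinct_uedges[OF es] e(2) by simp
  have closed: "walk G (origin G e) (e # es) (origin G e)"
    using es(1) by (simp add: simple_walk_def)
  show "\<forall>i<length (e # es). terminus G ((e # es) ! i)
      = origin G ((e # es) ! (Suc i mod length (e # es)))"
  proof (intro allI impI)
    fix i assume "i < length (e # es)"
    thus "terminus G ((e # es) ! i) = origin G ((e # es) ! (Suc i mod length (e # es)))"
      using walk_terminus_nth[OF closed, of i]
      by (cases "Suc i = length (e # es)") (auto simp: nth_append)
  qed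
qed (use es(2) e(1) in auto)

end

section \<open>Spanning trees and arborescences\<close>

locale rooted_multigraph = fin_multigraph G for G :: "('v, 'e) multigraph" +
  fixes r :: 'v
  assumes root_in: "r \<in> verts G"
begin

definition dart_choices :: "('v \<Rightarrow> 'e) set" where
  "dart_choices = (\<Pi>\<^sub>E v\<in>verts G - {r}. out_darts G v)"

text \<open>A rank exists exactly if following \<open>\<phi>\<close> from any vertex eventually leads to the root.\<close>

definition arborescences :: "('v \<Rightarrow> 'e) set" where
  "arborescences = {\<phi> \<in> dart_choices.
     \<exists>rank :: 'v \<Rightarrow> nat. \<forall>v\<in>verts G - {r}. rank (terminus G (\<phi> v)) < rank v}"

definition height :: "('v \<Rightarrow> 'e) \<Rightarrow> 'v \<Rightarrow> nat" where
  "height \<phi> = (SOME rank. \<forall>v\<in>verts G - {r}. rank (terminus G (\<phi> v)) < rank v)"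

definition tree_edges :: "('v \<Rightarrow> 'e) \<Rightarrow> 'e set set" where
  "tree_edges \<phi> = (\<lambda>v. uedge G (\<phi> v)) ` (verts G - {r})"

lemma finite_dart_choices: "finite dart_choices"
  unfolding dart_choices_def using finite_verts finite_darts by (intro finite_PiE) auto

lemma dart_choicesD:
  assumes "\<phi> \<in> dart_choices" "v \<in> verts G - {r}"
  shows "\<phi> v \<in> darts G" "origin G (\<phi> v) = v" "terminus G (\<phi> v) \<in> verts G"
proof -
  show "\<phi> v \<in> darts G" "origin G (\<phi> v) = v"
    using assms by (auto simp: dart_choices_def PiE_iff)
  thus "terminus G (\<phi> v) \<in> verts G" using terminus_in_verts by blast
qed

lemma height_less:
  assumes "\<phi> \<in> arborescences" "v \<in> verts G - {r}"
  shows "height \<phi> (terminus G (\<phi> v)) < height \<phi> v"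
proof -
  have "\<exists>rank :: 'v \<Rightarrow> nat. \<forall>v\<in>verts G - {r}. rank (terminus G (\<phi> v)) < rank v"
    using assms(1) by (simp add: arborescences_def)
  from someI_ex[OF this] show ?thesis using assms(2) unfolding height_def by blast
qed

lemma arborescences_subset: "arborescences \<subseteq> dart_choices"
  by (auto simp: arborescences_def)

lemma tree_edges_subset:
  assumes "\<phi> \<in> dart_choices"
  shows "tree_edges \<phi> \<subseteq> uedges G"
  using dart_choicesD(1)[OF assms] by (auto simp: tree_edges_def uedges_def)

lemma Union_tree_edges_cases:
  assumes "\<phi> \<in> dart_choices" "e \<in> \<Union> (tree_edges \<phi>)"
  obtains (along) v where
    "v \<in> verts G - {r}" "e = \<phi> v" "origin G e = v" "terminus G e = terminus G (\<phi> v)"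
  | (against) v where
    "v \<in> verts G - {r}" "e = opp G (\<phi> v)" "terminus G e = v" "origin G e = terminus G (\<phi> v)"
proof -
  obtain v where v: "v \<in> verts G - {r}" "e = \<phi> v \<or> e = opp G (\<phi> v)"
    using assms(2) by (auto simp: tree_edges_def uedge_def)
  note \<phi>v = dart_choicesD[OF assms(1) v(1)]
  from v(2) show thesis
  proof
    assume "e = \<phi> v"
    thus thesis using along v(1) \<phi>v by simp
  next
    assume "e = opp G (\<phi> v)"
    thus thesis using against v(1) \<phi>v inc_opp[OF \<phi>v(1)] by simp
  qed
qed

lemma arborescence_reaches_root:
  assumes \<phi>: "\<phi> \<in> arborescences" and "v \<in> verts G"
  shows "(v, r) \<in> (inc G ` \<Union> (tree_edges \<phi>))\<^sup>*"
  using \<open>v \<in> verts G\<close>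
proof (induction "height \<phi> v" arbitrary: v rule: less_induct)
  case less
  show ?case
  proof (cases "v = r")
    case False
    hence v: "v \<in> verts G - {r}" using less.prems by simp
    note \<phi>v = dart_choicesD[OF subsetD[OF arborescences_subset \<phi>] v]
    have "\<phi> v \<in> \<Union> (tree_edges \<phi>)" using v by (auto simp: tree_edges_def uedge_def)
    hence "(v, terminus G (\<phi> v)) \<in> inc G ` \<Union> (tree_edges \<phi>)"
      using \<phi>v(2) by (metis image_eqI prod.collapse)
    moreover have "(terminus G (\<phi> v), r) \<in> (inc G ` \<Union> (tree_edges \<phi>))\<^sup>*"
      using less.hyps height_less[OF \<phi> v] \<phi>v(3) by blast
    ultimately show ?thesis by (rule converse_rtrancl_into_rtrancl)
  qed simp
qed

lemma arborescence_connected: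
  assumes \<phi>: "\<phi> \<in> arborescences" and "u \<in> verts G" "w \<in> verts G"
  shows "(u, w) \<in> (inc G ` \<Union> (tree_edges \<phi>))\<^sup>*"
proof -
  have "sym ((inc G ` \<Union> (tree_edges \<phi>))\<^sup>*)"
    using \<phi> arborescences_subset by (intro sym_rtrancl sym_inc_image_Union tree_edges_subset) blast
  thus ?thesis using arborescence_reaches_root[OF \<phi>] assms(2,3) by (meson rtrancl_trans symD)
qed

text \<open>
  At a vertex of maximal height, a cycle would have to enter and leave along the same tree edge.
\<close>

lemma arborescence_acyclic:
  assumes \<phi>: "\<phi> \<in> arborescences" and es: "is_cycle G es"
  shows "\<not> set es \<subseteq> \<Union> (tree_edges \<phi>)"
proof
  assume sub: "set es \<subseteq> \<Union> (tree_edges \<phi>)"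
  have choices: "\<phi> \<in> dart_choices" using \<phi> arborescences_subset by blast
  let ?heights = "(\<lambda>d. height \<phi> (origin G d)) ` set es"
  have "Max ?heights \<in> ?heights" using es by (intro Max_in) (auto simp: is_cycle_def)
  then obtain e where e: "e \<in> set es" "height \<phi> (origin G e) = Max ?heights" by auto
  hence max: "height \<phi> (origin G d) \<le> height \<phi> (origin G e)" if "d \<in> set es" for d
    using that by simp
  obtain before where before: "before \<in> set es" "terminus G before = origin G e"
    using is_cycle_predecessor[OF es e(1)] .
  obtain after where after: "after \<in> set es" "origin G after = terminus G e"
    using is_cycle_successor[OF es e(1)] .
  have "e = \<phi> (origin G e)"
    using choices subsetD[OF sub e(1)]
  proof (cases rule: Union_tree_edges_cases)
    case (against v)
    thus ?thesis using height_less[OF \<phi>, of v] max[OF after(1)] after(2) by simp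
  qed simp
  moreover have "before = opp G (\<phi> (origin G e))"
    using choices subsetD[OF sub before(1)]
  proof (cases rule: Union_tree_edges_cases)
    case (along v)
    thus ?thesis using height_less[OF \<phi>, of v] max[OF before(1)] before(2) by simp
  qed (use before(2) in simp)
  ultimately have opp: "before = opp G e" by simp
  have "e \<in> darts G" using e es by (auto simp: is_cycle_def)
  hence "uedge G before = uedge G e" "before \<noteq> e" using opp uedge_opp opp_neq by simp_all
  moreover have "inj_on (uedge G) (set es)" using es by (simp add: is_cycle_def distinct_map)
  ultimately show False using e before(1) by (auto dest: inj_onD)
qed

lemma tree_edges_in_spanning_trees:
  assumes \<phi>: "\<phi> \<in> arborescences"
  shows "tree_edges \<phi> \<in> spanning_trees G"
proof -
  let ?T = "G\<lparr>darts := \<Union> (tree_edges \<phi>)\<rparr>"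
  have sub: "tree_edges \<phi> \<subseteq> uedges G" using \<phi> arborescences_subset tree_edges_subset by blast
  have "connected_multigraph ?T"
    unfolding connected_multigraph_def
    using root_in by (auto intro!: arborescence_connected[OF \<phi>])
  moreover have "\<nexists>es. is_cycle ?T es"
    using arborescence_acyclic[OF \<phi>] is_cycle_restrict_darts[OF Union_uedges_subset[OF sub]]
    by blast
  ultimately show ?thesis unfolding spanning_trees_def is_tree_def using sub by blast
qed

lemma inj_on_tree_edges: "inj_on tree_edges arborescences"
proof (rule inj_onI)
  fix \<phi> \<psi> assume \<phi>: "\<phi> \<in> arborescences" and \<psi>: "\<psi> \<in> arborescences"
    and eq: "tree_edges \<phi> = tree_edges \<psi>"
  have choices: "\<phi> \<in> dart_choices" "\<psi> \<in> dart_choices" using \<phi> \<psi> arborescences_subset by auto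
  have "\<phi> v = \<psi> v" if "v \<in> verts G - {r}" for v
    using that
  proof (induction "height \<phi> v" arbitrary: v rule: less_induct)
    case less
    have "\<phi> v \<in> \<Union> (tree_edges \<psi>)"
      unfolding eq[symmetric] using less.prems by (auto simp: tree_edges_def uedge_def)
    with choices(2) show ?case
    proof (cases rule: Union_tree_edges_cases)
      case (along w)
      thus ?thesis using dart_choicesD(2)[OF choices(1) less.prems] by simp
    next
      case (against w)
      have "terminus G (\<psi> w) = v" using against dart_choicesD(2)[OF choices(1) less.prems] by simp
      moreover have "height \<phi> w < height \<phi> v" using height_less[OF \<phi> less.prems] against by simp
      moreover hence "\<phi> w = \<psi> w" using less.hyps against by blast
      ultimately show ?thesis using height_less[OF \<phi> against(1)] by simp
    qed
  qed
  thus "\<phi> = \<psi>" using choices unfolding dart_choices_def by (rule PiE_ext[rotated 2])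
qed

lemma arborescence_exists:
  assumes "D \<subseteq> darts G" and reach: "\<And>v. v \<in> verts G \<Longrightarrow> (v, r) \<in> (inc G ` D)\<^sup>*"
  obtains \<phi> where "\<phi> \<in> arborescences" "\<phi> ` (verts G - {r}) \<subseteq> D"
proof -
  let ?R = "inc G ` D"
  define dist where "dist v = (LEAST k. (v, r) \<in> ?R ^^ k)" for v
  have "\<exists>e\<in>D. origin G e = v \<and> dist (terminus G e) < dist v" if v: "v \<in> verts G - {r}" for v
  proof -
    have "(v, r) \<in> ?R ^^ dist v"
      unfolding dist_def using reach v by (metis DiffD1 LeastI rtrancl_imp_relpow)
    moreover obtain m where m: "dist v = Suc m" using calculation v by (cases "dist v") auto
    ultimately obtain y where y: "(v, y) \<in> ?R" "(y, r) \<in> ?R ^^ m" by (metis relpow_Suc_D2)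
    have "dist y \<le> m" unfolding dist_def using y(2) by (rule Least_le)
    moreover obtain e where "e \<in> D" "inc G e = (v, y)" using y(1) by auto
    ultimately show ?thesis using m by (intro bexI[of _ e]) auto
  qed
  then obtain \<phi> where
    \<phi>: "\<And>v. v \<in> verts G - {r} \<Longrightarrow> \<phi> v \<in> D \<and> origin G (\<phi> v) = v \<and> dist (terminus G (\<phi> v)) < dist v"
    by metis
  show thesis
  proof (rule that)
    show "restrict \<phi> (verts G - {r}) \<in> arborescences"
      using \<phi> assms(1) by (auto simp: arborescences_def dart_choices_def intro!: exI[of _ dist])
    show "restrict \<phi> (verts G - {r}) ` (verts G - {r}) \<subseteq> D" using \<phi> by auto
  qed
qed

text \<open>Take for \<open>U\<close> the vertices from which \<open>\<phi>\<close> never reaches the root.\<close>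

lemma not_arborescence_trapped:
  assumes \<phi>: "\<phi> \<in> dart_choices" "\<phi> \<notin> arborescences"
  obtains U where "U \<subseteq> verts G - {r}" "U \<noteq> {}"
    "\<And>v. v \<in> verts G - {r} \<Longrightarrow> terminus G (\<phi> v) \<in> U \<longleftrightarrow> v \<in> U"
proof -
  define follow where "follow v = terminus G (\<phi> v)" for v
  define U where "U = {v \<in> verts G. \<forall>k. (follow ^^ k) v \<noteq> r}"
  have shift: "(follow ^^ Suc k) v = (follow ^^ k) (follow v)" for k v
    by (simp add: funpow_Suc_right del: funpow.simps)
  have "r \<notin> U" by (auto simp: U_def intro!: exI[of _ 0])
  moreover have "follow v \<in> U \<longleftrightarrow> v \<in> U" if v: "v \<in> verts G - {r}" for v
  proof -
    have "(\<forall>k. (follow ^^ k) v \<noteq> r) \<longleftrightarrow> (\<forall>k. (follow ^^ k) (follow v) \<noteq> r)"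
      using v shift by (metis DiffD2 funpow_0 insertI1 not0_implies_Suc)
    moreover have "follow v \<in> verts G" using dart_choicesD(3)[OF \<phi>(1) v] by (simp add: follow_def)
    ultimately show ?thesis using v by (simp add: U_def)
  qed
  moreover have "U \<noteq> {}"
  proof
    assume "U = {}"
    define dist where "dist v = (LEAST k. (follow ^^ k) v = r)" for v
    have "dist (terminus G (\<phi> v)) < dist v" if v: "v \<in> verts G - {r}" for v
    proof -
      obtain k where "(follow ^^ k) v = r" using \<open>U = {}\<close> v by (auto simp: U_def)
      hence "dist v = Suc (LEAST k. (follow ^^ Suc k) v = r)"
        unfolding dist_def using v by (intro Least_Suc) auto
      thus ?thesis by (simp add: dist_def shift follow_def[symmetric] del: funpow.simps)
    qed
    hence "\<phi> \<in> arborescences" using \<phi>(1) by (auto simp: arborescences_def)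
    thus False using \<phi>(2) by simp
  qed
  ultimately show thesis using that[of U] by (auto simp: U_def follow_def)
qed

text \<open>An edge of \<open>F\<close> outside the tree would close a path of the tree to a cycle.\<close>

lemma acyclic_superset_tree_edges:
  assumes \<phi>: "\<phi> \<in> arborescences" and F: "F \<subseteq> uedges G" "tree_edges \<phi> \<subseteq> F"
    and acyclic: "\<nexists>es. is_cycle G es \<and> set es \<subseteq> \<Union> F"
  shows "F = tree_edges \<phi>"
proof (intro equalityI F(2), rule ccontr)
  assume "\<not> F \<subseteq> tree_edges \<phi>"
  then obtain e where e: "e \<in> darts G" "uedge G e \<in> F" "uedge G e \<notin> tree_edges \<phi>"
    using F(1) by (auto simp: uedges_def)
  obtain es where es: "simple_walk G (terminus G e) es (origin G e)" "set es \<subseteq> \<Union> (tree_edges \<phi>)"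
    using simple_walk_exists[OF arborescence_connected[OF \<phi>]] terminus_in_verts origin_in_verts e(1)
    by blast
  have sub: "tree_edges \<phi> \<subseteq> uedges G" using F by simp
  have "uedge G d \<in> tree_edges \<phi>" if "d \<in> set es" for d
    using that es(2) uedge_of_mem[OF sub] by fastforce
  hence "is_cycle G (e # es)"
    using es e Union_uedges_subset[OF sub] by (intro is_cycle_Cons) auto
  moreover have "set (e # es) \<subseteq> \<Union> F" using e(2) es(2) F(2) by (auto simp: uedge_def)
  ultimately show False using acyclic by blast
qed

lemma spanning_trees_subset: "spanning_trees G \<subseteq> tree_edges ` arborescences"
proof
  fix F assume "F \<in> spanning_trees G"
  hence F: "F \<subseteq> uedges G" and con: "connected_multigraph (G\<lparr>darts := \<Union> F\<rparr>)"
    and acyclic: "\<nexists>es. is_cycle (G\<lparr>darts := \<Union> F\<rparr>) es"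
    by (auto simp: spanning_trees_def is_tree_def)
  note darts_F = Union_uedges_subset[OF F]
  obtain \<phi> where \<phi>: "\<phi> \<in> arborescences" "\<phi> ` (verts G - {r}) \<subseteq> \<Union> F"
    using arborescence_exists[OF darts_F] con root_in by (auto simp: connected_multigraph_def)
  have "tree_edges \<phi> \<subseteq> F" using \<phi>(2) uedge_of_mem[OF F] by (fastforce simp: tree_edges_def)
  hence "F = tree_edges \<phi>"
    using acyclic is_cycle_restrict_darts[OF darts_F]
    by (intro acyclic_superset_tree_edges \<phi>(1) F) auto
  thus "F \<in> tree_edges ` arborescences" using \<phi>(1) by blast
qed

lemma card_spanning_trees: "card (spanning_trees G) = card arborescences"
proof -
  have "tree_edges ` arborescences = spanning_trees G"
    using spanning_trees_subset tree_edges_in_spanning_trees by blast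
  thus ?thesis using card_image[OF inj_on_tree_edges] by simp
qed

end

lemma (in fin_multigraph) card_spanning_trees_pos:
  assumes "connected_multigraph G"
  shows "card (spanning_trees G) > 0"
proof -
  obtain r where "r \<in> verts G" using assms by (auto simp: connected_multigraph_def)
  then interpret rooted_multigraph G r by unfold_locales
  have "(v, r) \<in> (inc G ` darts G)\<^sup>*" if "v \<in> verts G" for v
    using assms that root_in by (simp add: connected_multigraph_def)
  then obtain \<phi> where "\<phi> \<in> arborescences" using arborescence_exists[OF subset_refl] by blast
  thus ?thesis
    using finite_subset[OF arborescences_subset finite_dart_choices]
    by (auto simp: card_spanning_trees card_gt_0_iff)
qed

section \<open>Determinants\<close>

lemma det_rank_triangular:
  fixes A :: "'a::comm_ring_1 mat" and rank :: "nat \<Rightarrow> nat"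
  assumes A: "A \<in> carrier_mat n n"
    and rank: "\<And>i j. i < n \<Longrightarrow> j < n \<Longrightarrow> i \<noteq> j \<Longrightarrow> A $$ (i, j) \<noteq> 0 \<Longrightarrow> rank j < rank i"
  shows "det A = (\<Prod>i = 0..<n. A $$ (i, i))"
proof -
  have vanish: "(\<Prod>i = 0..<n. A $$ (i, \<pi> i)) = 0" if \<pi>: "\<pi> permutes {0..<n}" "\<pi> \<noteq> id" for \<pi>
  proof -
    obtain i0 where "\<pi> i0 \<noteq> i0" using \<pi>(2) by (auto simp: fun_eq_iff)
    then obtain i where i: "\<pi> i \<noteq> i" and least: "\<And>j. \<pi> j \<noteq> j \<Longrightarrow> rank i \<le> rank j"
      using ex_has_least_nat[of "\<lambda>i. \<pi> i \<noteq> i" i0 rank] by blast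
    have lt: "i < n" "\<pi> i < n"
      using i permutes_in_image[OF \<pi>(1), of i] permutes_not_in[OF \<pi>(1), of i] by auto
    have "\<pi> (\<pi> i) \<noteq> \<pi> i" using i permutes_inj[OF \<pi>(1)] by (simp add: inj_eq)
    hence "A $$ (i, \<pi> i) = 0" using least[of "\<pi> i"] rank[OF lt] i by fastforce
    thus ?thesis using lt(1) by (intro prod_zero) auto
  qed
  have "det A = (\<Sum>\<pi> | \<pi> permutes {0..<n}. signof \<pi> * (\<Prod>i = 0..<n. A $$ (i, \<pi> i)))"
    by (rule det_def'[OF A])
  also have "\<dots> = (\<Sum>\<pi> | \<pi> permutes {0..<n}. if \<pi> = id then (\<Prod>i = 0..<n. A $$ (i, i)) else 0)"
    by (intro sum.cong refl) (auto simp: vanish)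
  also have "\<dots> = (\<Prod>i = 0..<n. A $$ (i, i))"
    by (simp add: finite_permutations permutes_id)
  finally show ?thesis .
qed

lemma prod_sum_PiE_reindex:
  fixes h :: "'i \<Rightarrow> 'b \<Rightarrow> 'a::comm_semiring_1"
  assumes f: "inj_on f I" and fin: "finite I" "\<And>i. i \<in> I \<Longrightarrow> finite (A (f i))"
  shows "(\<Prod>i\<in>I. \<Sum>a\<in>A (f i). h i a) = (\<Sum>\<phi>\<in>Pi\<^sub>E (f ` I) A. \<Prod>i\<in>I. h i (\<phi> (f i)))"
proof -
  define g where "g = the_inv_into I f"
  have g: "g (f i) = i" if "i \<in> I" for i unfolding g_def using f that by (rule the_inv_into_f_f)
  have "(\<Prod>i\<in>I. \<Sum>a\<in>A (f i). h i a) = (\<Prod>v\<in>f ` I. \<Sum>a\<in>A v. h (g v) a)"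
    by (simp add: prod.reindex[OF f] g)
  also have "\<dots> = (\<Sum>\<phi>\<in>Pi\<^sub>E (f ` I) A. \<Prod>v\<in>f ` I. h (g v) (\<phi> v))"
    using fin by (intro prod_sum_PiE) auto
  also have "\<dots> = (\<Sum>\<phi>\<in>Pi\<^sub>E (f ` I) A. \<Prod>i\<in>I. h i (\<phi> (f i)))"
    by (simp add: prod.reindex[OF f] g)
  finally show ?thesis .
qed

lemma det_sum_rows:
  fixes h :: "'v \<Rightarrow> 'b \<Rightarrow> nat \<Rightarrow> 'a::comm_ring_1"
  assumes us: "distinct us" and fin: "\<And>u. u \<in> set us \<Longrightarrow> finite (A u)"
  defines "n \<equiv> length us"
  shows "det (mat n n (\<lambda>(i, j). \<Sum>a\<in>A (us ! i). h (us ! i) a j))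
    = (\<Sum>\<phi>\<in>Pi\<^sub>E (set us) A. det (mat n n (\<lambda>(i, j). h (us ! i) (\<phi> (us ! i)) j)))"
proof -
  let ?perms = "{\<pi>. \<pi> permutes {0..<n}}"
  have inj: "inj_on ((!) us) {0..<n}" using us by (simp add: inj_on_nth n_def)
  have img: "(!) us ` {0..<n} = set us" by (auto simp: n_def set_conv_nth)
  have expand:
    "det (mat n n (\<lambda>(i, j). B i j)) = (\<Sum>\<pi>\<in>?perms. signof \<pi> * (\<Prod>i = 0..<n. B i (\<pi> i)))"
    for B :: "nat \<Rightarrow> nat \<Rightarrow> 'a"
    by (subst det_def'[of _ n]) (auto intro!: sum.cong prod.cong dest: permutes_in_image)
  have "(\<Prod>i = 0..<n. \<Sum>a\<in>A (us ! i). h (us ! i) a (\<pi> i))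
      = (\<Sum>\<phi>\<in>Pi\<^sub>E (set us) A. \<Prod>i = 0..<n. h (us ! i) (\<phi> (us ! i)) (\<pi> i))" for \<pi>
    using prod_sum_PiE_reindex[OF inj, of A "\<lambda>i a. h (us ! i) a (\<pi> i)"] fin
    by (simp add: img) (simp add: n_def)
  thus ?thesis
    unfolding expand by (simp add: sum_distrib_left sum.swap[of _ _ "Pi\<^sub>E (set us) A"])
qed

section \<open>The Laplacian and the matrix-tree theorem\<close>

definition laplacian_op :: "('v, 'e) multigraph \<Rightarrow> ('v \<Rightarrow> 'a::ab_group_add) \<Rightarrow> 'v \<Rightarrow> 'a" where
  "laplacian_op G x u = (\<Sum>e\<in>out_darts G u. x u - x (terminus G e))"

text \<open>The list need not contain all vertices: this is a principal submatrix in general.\<close>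

definition laplacian_matrix :: "('v, 'e) multigraph \<Rightarrow> 'v list \<Rightarrow> 'a::ring_1 mat" where
  "laplacian_matrix G us = mat (length us) (length us)
     (\<lambda>(i, j). laplacian_op G (\<lambda>w. of_bool (w = us ! j)) (us ! i))"

lemma laplacian_matrix_carrier: "laplacian_matrix G us \<in> carrier_mat (length us) (length us)"
  by (simp add: laplacian_matrix_def)

lemma laplacian_op_sum:
  fixes x :: "'j \<Rightarrow> 'v \<Rightarrow> 'a::ring"
  shows "laplacian_op G (\<lambda>w. \<Sum>j\<in>J. x j w * c j) u = (\<Sum>j\<in>J. laplacian_op G (x j) u * c j)"
  unfolding laplacian_op_def sum_distrib_right
  by (subst sum.swap) (simp add: left_diff_distrib sum_subtractf)

lemma sum_of_bool_nth:
  fixes x :: "'v \<Rightarrow> 'a::semiring_1"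
  assumes "distinct us"
  shows "(\<Sum>j<length us. of_bool (w = us ! j) * x (us ! j)) = of_bool (w \<in> set us) * x w"
proof -
  have "(\<Sum>j<length us. of_bool (w = us ! j) * x (us ! j)) = (\<Sum>u\<in>set us. of_bool (w = u) * x u)"
    using assms by (intro sum.reindex_bij_betw bij_betw_nth) auto
  thus ?thesis by (simp add: of_bool_def if_distrib[of "\<lambda>c. c * _"] cong: if_cong)
qed

lemma laplacian_matrix_mult_vec:
  fixes x :: "'v \<Rightarrow> 'a::comm_ring_1"
  assumes us: "distinct us" and x: "\<And>w. w \<notin> set us \<Longrightarrow> x w = 0"
  defines "n \<equiv> length us"
  shows "laplacian_matrix G us *\<^sub>v vec n (\<lambda>i. x (us ! i)) = vec n (\<lambda>i. laplacian_op G x (us ! i))"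
proof (rule eq_vecI)
  fix i assume "i < dim_vec (vec n (\<lambda>i. laplacian_op G x (us ! i)))"
  hence i: "i < n" by simp
  have "(laplacian_matrix G us *\<^sub>v vec n (\<lambda>i. x (us ! i))) $ i
      = (\<Sum>j<n. laplacian_op G (\<lambda>w. of_bool (w = us ! j)) (us ! i) * x (us ! j))"
    using i by (simp add: laplacian_matrix_def n_def scalar_prod_def atLeast0LessThan)
  also have "\<dots> = laplacian_op G (\<lambda>w. \<Sum>j<n. of_bool (w = us ! j) * x (us ! j)) (us ! i)"
    by (rule laplacian_op_sum[symmetric])
  also have "(\<lambda>w. \<Sum>j<n. of_bool (w = us ! j) * x (us ! j)) = x"
    unfolding n_def sum_of_bool_nth[OF us] using x by fastforce
  finally show "(laplacian_matrix G us *\<^sub>v vec n (\<lambda>i. x (us ! i))) $ i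
      = vec n (\<lambda>i. laplacian_op G x (us ! i)) $ i"
    using i by simp
qed (simp add: laplacian_matrix_def n_def)

lemma det_laplacian_matrix_eq_0:
  fixes x :: "'v \<Rightarrow> 'a::idom"
  assumes us: "distinct us" and x: "\<And>w. w \<notin> set us \<Longrightarrow> x w = 0"
    and harmonic: "\<And>u. u \<in> set us \<Longrightarrow> laplacian_op G x u = 0"
    and u: "u \<in> set us" "x u \<noteq> 0"
  shows "det (laplacian_matrix G us :: 'a mat) = 0"
proof -
  let ?n = "length us" and ?x = "vec (length us) (\<lambda>i. x (us ! i))"
  obtain i where "i < ?n" "us ! i = u" using u(1) by (auto simp: in_set_conv_nth)
  hence "?x $ i \<noteq> 0\<^sub>v ?n $ i" using u(2) by simp
  hence "?x \<noteq> 0\<^sub>v ?n" by auto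
  moreover have "laplacian_matrix G us *\<^sub>v ?x = vec ?n (\<lambda>i. laplacian_op G x (us ! i))"
    using us x by (rule laplacian_matrix_mult_vec)
  moreover have "\<dots> = 0\<^sub>v ?n" using harmonic by (intro eq_vecI) auto
  ultimately show ?thesis
    using det_0_iff_vec_prod_zero[OF laplacian_matrix_carrier] vec_carrier by metis
qed

lemma (in fin_multigraph) det_laplacian_matrix_verts:
  assumes "distinct vs" "set vs = verts G" "verts G \<noteq> {}"
  shows "det (laplacian_matrix G vs :: 'a::idom mat) = 0"
proof -
  obtain u where "u \<in> verts G" using assms(3) by blast
  thus ?thesis
    using assms terminus_in_verts
    by (intro det_laplacian_matrix_eq_0[where x = "\<lambda>w. of_bool (w \<in> verts G)" and u = u])
       (auto simp: laplacian_op_def intro!: sum.neutral)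
qed

context rooted_multigraph
begin

definition choice_graph :: "('v \<Rightarrow> 'e) \<Rightarrow> ('v, 'e) multigraph" where
  "choice_graph \<phi> = G\<lparr>darts := \<phi> ` (verts G - {r})\<rparr>"

lemma laplacian_op_choice_graph:
  fixes x :: "'v \<Rightarrow> 'a::ab_group_add"
  assumes \<phi>: "\<phi> \<in> dart_choices" and u: "u \<in> verts G - {r}"
  shows "laplacian_op (choice_graph \<phi>) x u = x u - x (terminus G (\<phi> u))"
proof -
  have "out_darts (choice_graph \<phi>) u = \<phi> ` {v \<in> verts G - {r}. origin G (\<phi> v) = u}"
    by (auto simp: choice_graph_def)
  also have "{v \<in> verts G - {r}. origin G (\<phi> v) = u} = {u}"
    using dart_choicesD(2)[OF \<phi>] u by auto
  finally have "out_darts (choice_graph \<phi>) u = {\<phi> u}" by simp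
  thus ?thesis by (simp add: laplacian_op_def) (simp add: choice_graph_def)
qed

context
  fixes us :: "'v list"
  assumes us: "distinct us" "set us = verts G - {r}"
begin

lemma det_laplacian_matrix_arborescence:
  assumes \<phi>: "\<phi> \<in> arborescences"
  shows "det (laplacian_matrix (choice_graph \<phi>) us :: 'a::comm_ring_1 mat) = 1"
proof -
  let ?L = "laplacian_matrix (choice_graph \<phi>) us :: 'a mat"
  have entry: "?L $$ (i, j) = of_bool (i = j) - of_bool (terminus G (\<phi> (us ! i)) = us ! j)"
    if "i < length us" "j < length us" for i j
    using that us subsetD[OF arborescences_subset \<phi>] nth_mem[OF that(1)]
    by (simp add: laplacian_matrix_def laplacian_op_choice_graph nth_eq_iff_index_eq)
  have height_us: "height \<phi> (terminus G (\<phi> (us ! i))) < height \<phi> (us ! i)" if "i < length us" for i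
    using height_less[OF \<phi>] us(2) nth_mem[OF that] by blast
  have "det ?L = (\<Prod>i = 0..<length us. ?L $$ (i, i))"
    using height_us by (intro det_rank_triangular[where rank = "\<lambda>i. height \<phi> (us ! i)"]
        laplacian_matrix_carrier) (force simp: entry of_bool_def split: if_splits)
  also have "\<dots> = 1"
    using height_us by (intro prod.neutral) (force simp: entry of_bool_def)
  finally show ?thesis .
qed

lemma det_laplacian_matrix_not_arborescence:
  assumes \<phi>: "\<phi> \<in> dart_choices" "\<phi> \<notin> arborescences"
  shows "det (laplacian_matrix (choice_graph \<phi>) us :: 'a::idom mat) = 0"
proof -
  obtain U where U: "U \<subseteq> verts G - {r}" "U \<noteq> {}"
      "\<And>v. v \<in> verts G - {r} \<Longrightarrow> terminus G (\<phi> v) \<in> U \<longleftrightarrow> v \<in> U"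
    using \<phi> not_arborescence_trapped by blast
  obtain u where "u \<in> U" using U(2) by blast
  thus ?thesis
    using us U(1,3)
    by (intro det_laplacian_matrix_eq_0[where x = "\<lambda>w. of_bool (w \<in> U)" and u = u])
       (auto simp: laplacian_op_choice_graph[OF \<phi>(1)])
qed

text \<open>
  Each row of the Laplacian is a sum over the darts leaving a vertex; multilinearity of the
  determinant in the rows turns it into a sum over all choices of one dart per vertex.
\<close>

theorem matrix_tree:
  "det (laplacian_matrix G us) = (of_nat (card (spanning_trees G)) :: 'a::idom)"
proof -
  define h :: "'v \<Rightarrow> 'e \<Rightarrow> nat \<Rightarrow> 'a" where
    "h u e j = of_bool (u = us ! j) - of_bool (terminus G e = us ! j)" for u e j
  have "det (laplacian_matrix G us :: 'a mat)
      = (\<Sum>\<phi>\<in>dart_choices. det (mat (length us) (length us)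
          (\<lambda>(i, j). h (us ! i) (\<phi> (us ! i)) j)))"
    unfolding dart_choices_def us(2)[symmetric] laplacian_matrix_def laplacian_op_def h_def
    using us(1) finite_darts by (intro det_sum_rows) auto
  also have "\<dots> = (\<Sum>\<phi>\<in>dart_choices. det (laplacian_matrix (choice_graph \<phi>) us))"
    using us(2) by (intro sum.cong refl arg_cong[where f = det] eq_matI)
       (use nth_mem[of _ us] in \<open>auto simp: laplacian_matrix_def laplacian_op_choice_graph h_def\<close>)
  also have "\<dots> = (\<Sum>\<phi>\<in>dart_choices. of_bool (\<phi> \<in> arborescences))"
    by (intro sum.cong refl)
       (auto simp: det_laplacian_matrix_arborescence det_laplacian_matrix_not_arborescence)
  also have "\<dots> = of_nat (card (dart_choices \<inter> arborescences))"
    using finite_dart_choices by (simp add: of_bool_def sum.If_cases)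
  also have "dart_choices \<inter> arborescences = arborescences" using arborescences_subset by blast
  finally show ?thesis by (simp add: card_spanning_trees)
qed

end

end

lemma mat_delete_laplacian_matrix:
  assumes "i < length vs"
  shows "mat_delete (laplacian_matrix G vs) i i = laplacian_matrix G (take i vs @ drop (Suc i) vs)"
proof -
  have "(take i vs @ drop (Suc i) vs) ! j = vs ! (if j < i then j else Suc j)"
    if "j < length vs - 1" for j
    using that assms by (auto simp: nth_append)
  thus ?thesis using assms by (intro eq_matI) (auto simp: mat_delete_def laplacian_matrix_def)
qed

lemma poly_char_poly_0:
  fixes A :: "'a::comm_ring_1 mat"
  assumes "A \<in> carrier_mat n n"
  shows "poly (char_poly A) 0 = (- 1) ^ n * det A"
proof -
  have hom: "comm_ring_hom (\<lambda>q :: 'a poly. poly q 0)" by unfold_locales auto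
  have "poly (char_poly A) 0 = det (map_mat (\<lambda>q. poly q 0) (char_poly_matrix A))"
    by (simp only: char_poly_def comm_ring_hom.hom_det[OF hom])
  also have "map_mat (\<lambda>q. poly q 0) (char_poly_matrix A) = (- 1) \<cdot>\<^sub>m A"
    using assms by (intro eq_matI) (auto simp: char_poly_matrix_def)
  finally show ?thesis using assms by simp
qed

lemma (in fin_multigraph) pderiv_char_poly_laplacian_matrix:
  assumes vs: "distinct vs" "set vs = verts G"
  shows "poly (pderiv (char_poly (laplacian_matrix G vs))) 0
    = ((- 1) ^ (length vs - 1) * of_nat (length vs * card (spanning_trees G)) :: 'a::idom)"
proof -
  let ?L = "laplacian_matrix G vs :: 'a mat" and ?n = "length vs"
  have "poly (char_poly (mat_delete ?L i i)) 0
      = (- 1) ^ (?n - 1) * of_nat (card (spanning_trees G))"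
    if i: "i < ?n" for i
  proof -
    let ?us = "take i vs @ drop (Suc i) vs"
    have split: "vs = take i vs @ vs ! i # drop (Suc i) vs" using i by (rule id_take_nth_drop)
    hence "distinct (take i vs @ vs ! i # drop (Suc i) vs)" using vs(1) by simp
    hence us: "distinct ?us" "vs ! i \<notin> set ?us" by auto
    have "set vs = insert (vs ! i) (set ?us)" by (subst split) auto
    hence set_us: "set ?us = verts G - {vs ! i}" using us(2) vs(2) by auto
    have "vs ! i \<in> verts G" using nth_mem[OF i] vs(2) by simp
    then interpret rooted_multigraph G "vs ! i" by unfold_locales
    have "poly (char_poly (mat_delete ?L i i)) 0 = (- 1) ^ (?n - 1) * det (mat_delete ?L i i)"
      by (intro poly_char_poly_0 mat_delete_carrier laplacian_matrix_carrier)
    also have "det (mat_delete ?L i i) = of_nat (card (spanning_trees G))"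
      unfolding mat_delete_laplacian_matrix[OF i] by (rule matrix_tree[OF us(1) set_us])
    finally show ?thesis .
  qed
  thus ?thesis
    by (simp add: pderiv_char_poly[OF laplacian_matrix_carrier] poly_sum algebra_simps)
qed

section \<open>Roots of unity\<close>

lemma power_mod_exponent:
  fixes \<xi> :: "'a::monoid_mult"
  assumes "\<xi> ^ N = 1"
  shows "\<xi> ^ (k mod N) = \<xi> ^ k"
proof -
  have "\<xi> ^ k = \<xi> ^ (N * (k div N) + k mod N)" by simp
  also have "\<dots> = \<xi> ^ (k mod N)" by (simp only: power_add power_mult assms power_one mult_1_left)
  finally show ?thesis ..
qed

lemma power_of_root_of_unity:
  fixes \<xi> :: "'a::monoid_mult"
  assumes "\<xi> ^ N = 1"
  shows "(\<xi> ^ k) ^ N = 1"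
  using assms by (metis mult.commute power_mult power_one)

lemma power_int_mod_exponent:
  fixes \<xi> :: "'a::field"
  assumes "\<xi> ^ N = 1" and "\<xi> \<noteq> 0"
  shows "\<xi> powi (k mod int N) = \<xi> powi k"
proof -
  have "\<xi> powi k = \<xi> powi (int N * (k div int N) + k mod int N)" by simp
  also have "\<dots> = (\<xi> powi int N) powi (k div int N) * \<xi> powi (k mod int N)"
    using assms(2) by (subst power_int_add) (simp_all add: power_int_mult)
  also have "\<dots> = \<xi> powi (k mod int N)" using assms(1) by simp
  finally show ?thesis ..
qed

lemma primitive_root_power_self: "primitive_root_of_unity N \<zeta> \<Longrightarrow> \<zeta> ^ N = 1"
  by (simp add: primitive_root_of_unity_def)

lemma primitive_root_power_eq_1_iff:
  assumes "primitive_root_of_unity N \<zeta>" and "N > 0"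
  shows "\<zeta> ^ k = 1 \<longleftrightarrow> N dvd k"
proof -
  have "\<zeta> ^ N = 1" using assms(1) by (rule primitive_root_power_self)
  hence "\<zeta> ^ k = 1 \<longleftrightarrow> \<zeta> ^ (k mod N) = 1" by (simp add: power_mod_exponent)
  also have "\<dots> \<longleftrightarrow> k mod N = 0"
    using assms by (metis gr0I mod_less_divisor power_0 primitive_root_of_unity_def)
  finally show ?thesis by (simp add: dvd_eq_mod_eq_0)
qed

lemma primitive_root_coprime_power:
  assumes \<zeta>: "primitive_root_of_unity N \<zeta>" and "coprime t N" "N > 0"
  shows "primitive_root_of_unity N (\<zeta> ^ t)"
proof -
  have "(\<zeta> ^ t) ^ k = 1 \<longleftrightarrow> N dvd k" for k
    using assms primitive_root_power_eq_1_iff[OF \<zeta>, of "t * k"]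
    by (simp add: power_mult coprime_commute coprime_dvd_mult_right_iff)
  thus ?thesis by (auto simp: primitive_root_of_unity_def dest: dvd_imp_le)
qed

lemma sum_powers_root_of_unity:
  fixes \<omega> :: "'a::field"
  assumes "\<omega> ^ N = 1"
  shows "(\<Sum>t<N. \<omega> ^ t) = (if \<omega> = 1 then of_nat N else 0)"
  using assms by (simp add: geometric_sum)

lemma primitive_root_orthogonality:
  fixes \<zeta> :: "'a::field"
  assumes \<zeta>: "primitive_root_of_unity N \<zeta>" and "s < N" "t < N"
  shows "(\<Sum>\<tau><N. \<zeta> ^ (s * \<tau>) * inverse \<zeta> ^ (\<tau> * t)) = (if s = t then of_nat N else 0)"
proof -
  have \<zeta>N: "\<zeta> ^ N = 1" using \<zeta> by (rule primitive_root_power_self)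
  define \<omega> where "\<omega> = \<zeta> ^ (s + (N - t))"
  have "\<zeta> ^ t * \<zeta> ^ (N - t) = 1" using \<open>t < N\<close> \<zeta>N by (simp flip: power_add)
  hence "inverse \<zeta> ^ t = \<zeta> ^ (N - t)" by (metis inverse_unique power_inverse)
  hence "\<zeta> ^ (s * \<tau>) * inverse \<zeta> ^ (\<tau> * t) = \<omega> ^ \<tau>" for \<tau>
    by (simp add: \<omega>_def power_add power_mult_distrib power_mult mult.commute[of \<tau>])
  moreover have "\<omega> ^ N = 1" unfolding \<omega>_def by (rule power_of_root_of_unity[OF \<zeta>N])
  moreover have "\<omega> = 1 \<longleftrightarrow> s = t"
  proof -
    have "\<omega> = 1 \<longleftrightarrow> N dvd s + (N - t)"
      unfolding \<omega>_def using primitive_root_power_eq_1_iff[OF \<zeta>] \<open>t < N\<close> by simp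
    also have "\<dots> \<longleftrightarrow> s = t"
    proof (cases "s < t")
      case True
      thus ?thesis using \<open>t < N\<close> nat_dvd_not_less[of "s + (N - t)" N] by auto
    next
      case False
      hence "s + (N - t) = (s - t) + N" using \<open>t < N\<close> by simp
      hence "N dvd s + (N - t) \<longleftrightarrow> N dvd s - t" by simp
      thus ?thesis using False \<open>s < N\<close> by (auto dest: dvd_imp_le)
    qed
    finally show ?thesis .
  qed
  ultimately show ?thesis by (simp add: sum_powers_root_of_unity)
qed

section \<open>Block matrices and the discrete Fourier transform\<close>

definition block_mat :: "nat \<Rightarrow> nat \<Rightarrow> (nat \<Rightarrow> nat \<Rightarrow> nat \<Rightarrow> nat \<Rightarrow> 'a) \<Rightarrow> 'a mat" where
  "block_mat g N a = mat (N * g) (N * g)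
     (\<lambda>(k, k'). a (k div g) (k' div g) (k mod g) (k' mod g))"

lemma block_mat_carrier: "block_mat g N a \<in> carrier_mat (N * g) (N * g)"
  by (simp add: block_mat_def)

lemma block_mat_cong:
  assumes "\<And>\<sigma> \<tau> i j. \<sigma> < N \<Longrightarrow> \<tau> < N \<Longrightarrow> i < g \<Longrightarrow> j < g \<Longrightarrow> a \<sigma> \<tau> i j = b \<sigma> \<tau> i j"
  shows "block_mat g N a = block_mat g N b"
proof (cases "g = 0")
  case False
  thus ?thesis unfolding block_mat_def
    by (intro eq_matI) (auto intro!: assms simp: less_mult_imp_div_less)
qed (auto simp: block_mat_def)

lemma sum_div_mod:
  fixes h :: "nat \<Rightarrow> nat \<Rightarrow> 'a::comm_monoid_add"
  shows "(\<Sum>k<N * g. h (k div g) (k mod g)) = (\<Sum>\<rho><N. \<Sum>m<g. h \<rho> m)"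
proof -
  have "(\<Sum>k<N * g. h (k div g) (k mod g))
      = (\<Sum>\<rho><N. \<Sum>k\<in>{\<rho> * g..<\<rho> * g + g}. h (k div g) (k mod g))"
    using sum.nat_group[of "\<lambda>k. h (k div g) (k mod g)" g N] by simp
  also have "\<dots> = (\<Sum>\<rho><N. \<Sum>m<g. h \<rho> m)"
  proof (rule sum.cong[OF refl])
    fix \<rho>
    have "(\<Sum>k\<in>{\<rho> * g..<\<rho> * g + g}. h (k div g) (k mod g))
        = (\<Sum>m\<in>{0..<g}. h ((m + \<rho> * g) div g) ((m + \<rho> * g) mod g))"
      using sum.shift_bounds_nat_ivl[of "\<lambda>k. h (k div g) (k mod g)" 0 "\<rho> * g" g]
      by (simp add: add.commute)
    thus "(\<Sum>k\<in>{\<rho> * g..<\<rho> * g + g}. h (k div g) (k mod g)) = (\<Sum>m<g. h \<rho> m)"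
      by (simp add: atLeast0LessThan)
  qed
  finally show ?thesis .
qed

lemma block_mat_mult:
  fixes a b :: "nat \<Rightarrow> nat \<Rightarrow> nat \<Rightarrow> nat \<Rightarrow> 'a::semiring_0"
  shows "block_mat g N a * block_mat g N b
    = block_mat g N (\<lambda>\<sigma> \<tau> i j. \<Sum>\<rho><N. \<Sum>m<g. a \<sigma> \<rho> i m * b \<rho> \<tau> m j)"
    (is "_ = block_mat g N ?ab")
proof (rule eq_matI)
  fix k k' assume "k < dim_row (block_mat g N ?ab)" "k' < dim_col (block_mat g N ?ab)"
  thus "(block_mat g N a * block_mat g N b) $$ (k, k') = block_mat g N ?ab $$ (k, k')"
    using sum_div_mod[of "\<lambda>\<rho> m. a (k div g) \<rho> (k mod g) m * b \<rho> (k' div g) m (k' mod g)" g N]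
    by (simp add: block_mat_def scalar_prod_def atLeast0LessThan)
qed (simp_all add: block_mat_def)

lemma block_mat_one: "block_mat g N (\<lambda>\<sigma> \<tau> i j. if \<sigma> = \<tau> \<and> i = j then 1 else 0) = 1\<^sub>m (N * g)"
proof -
  have "k div g = k' div g \<and> k mod g = k' mod g \<longleftrightarrow> k = k'" for k k' by (metis div_mult_mod_eq)
  thus ?thesis unfolding block_mat_def by (intro eq_matI) auto
qed

definition block_diag :: "nat \<Rightarrow> nat \<Rightarrow> (nat \<Rightarrow> 'a mat) \<Rightarrow> 'a::zero mat" where
  "block_diag g N M = block_mat g N (\<lambda>\<sigma> \<tau> i j. if \<sigma> = \<tau> then M \<sigma> $$ (i, j) else 0)"

lemma block_diag_Suc:
  assumes M: "M N \<in> carrier_mat g g"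
  shows "block_diag g (Suc N) M
    = four_block_mat (block_diag g N M) (0\<^sub>m (N * g) g) (0\<^sub>m g (N * g)) (M N)"
proof (rule eq_matI)
  let ?B = "four_block_mat (block_diag g N M) (0\<^sub>m (N * g) g) (0\<^sub>m g (N * g)) (M N)"
  fix k k' assume "k < dim_row ?B" "k' < dim_col ?B"
  hence k: "k < N * g + g" "k' < N * g + g" using M by (auto simp: block_diag_def block_mat_def)
  have block: "k div g < N" if "k < N * g" for k using that by (rule less_mult_imp_div_less)
  have last: "k div g = N \<and> k mod g = k - N * g" if "\<not> k < N * g" "k < N * g + g" for k
  proof -
    define j where "j = k - N * g"
    have "k = N * g + j" "j < g" using that by (simp_all add: j_def)
    thus ?thesis by simp
  qed
  show "block_diag g (Suc N) M $$ (k, k') = ?B $$ (k, k')"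
    using M k block[of k] block[of k'] last[of k] last[of k']
    by (cases "k < N * g"; cases "k' < N * g") (simp_all add: block_diag_def block_mat_def)
qed (use M in \<open>simp_all add: block_diag_def block_mat_def\<close>)

lemma char_poly_four_block_diag:
  fixes A D :: "'a::idom mat"
  assumes A: "A \<in> carrier_mat n n" and D: "D \<in> carrier_mat m m"
  shows "char_poly (four_block_mat A (0\<^sub>m n m) (0\<^sub>m m n) D) = char_poly A * char_poly D"
proof -
  let ?B = "four_block_mat A (0\<^sub>m n m) (0\<^sub>m m n) D"
  have B: "?B \<in> carrier_mat (n + m) (n + m)" using A D by simp
  have entry:
    "char_poly_matrix M $$ (i, j) = (if i = j then [:- M $$ (i, j), 1:] else [:- M $$ (i, j):])"
    if "M \<in> carrier_mat k k" "i < k" "j < k" for M :: "'a mat" and i j k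
    using that by (simp add: char_poly_matrix_def)
  note dims = carrier_matD[OF char_poly_matrix_closed[OF A]]
    carrier_matD[OF char_poly_matrix_closed[OF B]] carrier_matD[OF char_poly_matrix_closed[OF D]]
  have "char_poly_matrix ?B
      = four_block_mat (char_poly_matrix A) (0\<^sub>m n m) (0\<^sub>m m n) (char_poly_matrix D)"
    (is "_ = ?R")
  proof (rule eq_matI)
    fix i j assume "i < dim_row ?R" "j < dim_col ?R"
    hence "i < n + m" "j < n + m" by (simp_all add: dims)
    thus "char_poly_matrix ?B $$ (i, j) = ?R $$ (i, j)"
      using A D
      by (cases "i < n"; cases "j < n") (auto simp: entry[OF B] entry[OF A] entry[OF D] dims)
  qed (simp_all add: dims)
  thus ?thesis
    unfolding char_poly_def
    using det_four_block_mat_lower_left_zero[of "char_poly_matrix A" n "0\<^sub>m n m" m "0\<^sub>m m n"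
        "char_poly_matrix D"] A D
    by simp
qed

lemma char_poly_block_diag:
  fixes M :: "nat \<Rightarrow> 'a::idom mat"
  assumes "\<And>t. t < N \<Longrightarrow> M t \<in> carrier_mat g g"
  shows "char_poly (block_diag g N M) = (\<Prod>t<N. char_poly (M t))"
  using assms
proof (induction N)
  case 0
  have "char_poly_matrix (block_diag g 0 M) \<in> carrier_mat 0 0"
    by (simp add: block_diag_def block_mat_def)
  thus ?case by (simp add: char_poly_def)
next
  case (Suc N)
  have "block_diag g N M \<in> carrier_mat (N * g) (N * g)"
    unfolding block_diag_def by (rule block_mat_carrier)
  moreover have "M N \<in> carrier_mat g g" using Suc.prems by simp
  ultimately have
    "char_poly (block_diag g (Suc N) M) = char_poly (block_diag g N M) * char_poly (M N)"
    by (simp add: block_diag_Suc char_poly_four_block_diag)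
  thus ?case using Suc by simp
qed

definition fourier_mat :: "nat \<Rightarrow> nat \<Rightarrow> 'a \<Rightarrow> 'a::semiring_1 mat" where
  "fourier_mat g N \<zeta> = block_mat g N (\<lambda>\<sigma> \<tau> i j. if i = j then \<zeta> ^ (\<sigma> * \<tau>) else 0)"

lemma fourier_mat_carrier: "fourier_mat g N \<zeta> \<in> carrier_mat (N * g) (N * g)"
  unfolding fourier_mat_def by (rule block_mat_carrier)

lemma block_mat_mult_fourier_mat:
  "block_mat g N a * fourier_mat g N \<zeta>
    = block_mat g N (\<lambda>\<sigma> t i j. \<Sum>\<tau><N. a \<sigma> \<tau> i j * \<zeta> ^ (\<tau> * t))"
  unfolding fourier_mat_def block_mat_mult
  by (rule block_mat_cong) (simp add: if_distrib[of "(*) _"] cong: if_cong)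

lemma fourier_mat_mult_block_mat:
  "fourier_mat g N \<zeta> * block_mat g N a
    = block_mat g N (\<lambda>\<sigma> t i j. \<Sum>\<tau><N. \<zeta> ^ (\<sigma> * \<tau>) * a \<tau> t i j)"
  unfolding fourier_mat_def block_mat_mult
  by (rule block_mat_cong) (simp add: if_distrib[of "\<lambda>x. x * _"] cong: if_cong)

lemma fourier_mat_mult_inverse:
  fixes \<zeta> :: "'a::field"
  assumes "primitive_root_of_unity N \<zeta>"
  shows "fourier_mat g N \<zeta> * fourier_mat g N (inverse \<zeta>) = of_nat N \<cdot>\<^sub>m 1\<^sub>m (N * g)"
proof -
  have "fourier_mat g N \<zeta> * fourier_mat g N (inverse \<zeta>)
      = block_mat g N (\<lambda>\<sigma> t i j. of_nat N * (if \<sigma> = t \<and> i = j then 1 else 0))"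
    unfolding fourier_mat_def[of g N \<zeta>] block_mat_mult_fourier_mat
  proof (rule block_mat_cong)
    show "(\<Sum>\<tau><N. (if i = j then \<zeta> ^ (\<sigma> * \<tau>) else 0) * inverse \<zeta> ^ (\<tau> * t))
        = of_nat N * (if \<sigma> = t \<and> i = j then 1 else 0)"
      if "\<sigma> < N" "t < N" for \<sigma> t i j
      using that by (cases "i = j") (simp_all add: primitive_root_orthogonality[OF assms])
  qed
  also have "\<dots> = of_nat N \<cdot>\<^sub>m 1\<^sub>m (N * g)"
    unfolding block_mat_one[symmetric] by (auto simp: block_mat_def)
  finally show ?thesis .
qed

text \<open>
  The hypothesis says that the block rows of \<open>a\<close> act on the geometric vectors \<open>(\<zeta>^(\<tau> t))\<close> by
  \<open>M t\<close>, so that the discrete Fourier matrix conjugates \<open>a\<close> into the block diagonal of the \<open>M t\<close>.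
\<close>

lemma char_poly_block_fourier:
  fixes \<zeta> :: "'a::field" and M :: "nat \<Rightarrow> 'a mat"
  assumes N: "of_nat N \<noteq> (0 :: 'a)" and \<zeta>: "primitive_root_of_unity N \<zeta>"
    and M: "\<And>t. t < N \<Longrightarrow> M t \<in> carrier_mat g g"
    and eig: "\<And>\<sigma> t i j. \<sigma> < N \<Longrightarrow> t < N \<Longrightarrow> i < g \<Longrightarrow> j < g \<Longrightarrow>
      (\<Sum>\<tau><N. a \<sigma> \<tau> i j * \<zeta> ^ (\<tau> * t)) = \<zeta> ^ (\<sigma> * t) * M t $$ (i, j)"
  shows "char_poly (block_mat g N a) = (\<Prod>t<N. char_poly (M t))"
proof -
  let ?A = "block_mat g N a" and ?D = "block_diag g N M"
  let ?P = "fourier_mat g N \<zeta>" and ?Q = "inverse (of_nat N) \<cdot>\<^sub>m fourier_mat g N (inverse \<zeta>)"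
  have carrier: "?A \<in> carrier_mat (N * g) (N * g)" "?D \<in> carrier_mat (N * g) (N * g)"
    "?P \<in> carrier_mat (N * g) (N * g)" "?Q \<in> carrier_mat (N * g) (N * g)"
    by (simp_all add: block_diag_def block_mat_carrier fourier_mat_carrier)
  have AP: "?A * ?P = ?P * ?D"
    unfolding block_mat_mult_fourier_mat block_diag_def fourier_mat_mult_block_mat
    by (rule block_mat_cong) (simp add: eig if_distrib[of "(*) _"] cong: if_cong)
  have "?P * ?Q = inverse (of_nat N) \<cdot>\<^sub>m (?P * fourier_mat g N (inverse \<zeta>))"
    by (rule mult_smult_distrib[OF fourier_mat_carrier fourier_mat_carrier])
  also have "\<dots> = 1\<^sub>m (N * g)"
    unfolding fourier_mat_mult_inverse[OF \<zeta>] using N by (intro eq_matI) auto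
  finally have PQ: "?P * ?Q = 1\<^sub>m (N * g)" .
  have QP: "?Q * ?P = 1\<^sub>m (N * g)" by (rule mat_mult_left_right_inverse[OF carrier(3,4) PQ])
  have "?A = ?A * (?P * ?Q)" using carrier PQ by simp
  also have "\<dots> = ?P * ?D * ?Q" using carrier AP by (simp flip: assoc_mult_mat)
  finally have "similar_mat ?A ?D" using carrier PQ QP by (intro similar_matI[of ?A ?D ?P ?Q]) auto
  hence "char_poly ?A = char_poly ?D" by (rule char_poly_similar)
  also have "\<dots> = (\<Prod>t<N. char_poly (M t))" using M by (rule char_poly_block_diag)
  finally show ?thesis .
qed

section \<open>Spanning trees of cyclic covers\<close>

definition twisted_laplacian ::
  "('v, 'e) multigraph \<Rightarrow> 'v list \<Rightarrow> 'e set \<Rightarrow> ('e \<Rightarrow> int) \<Rightarrow> 'a::field \<Rightarrow> 'a mat" where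
  "twisted_laplacian G vs S \<beta> \<xi> = mat (length vs) (length vs) (\<lambda>(i, j).
     (if i = j then of_nat (valency G (vs ! i)) else 0) -
     ((\<Sum>s\<in>{s \<in> S. inc G s = (vs ! i, vs ! j)}. \<xi> powi \<beta> s) +
      (\<Sum>s\<in>{s \<in> S. inc G s = (vs ! j, vs ! i)}. \<xi> powi (- \<beta> s))))"

lemma twisted_laplacian_carrier:
  "twisted_laplacian G vs S \<beta> \<xi> \<in> carrier_mat (length vs) (length vs)"
  by (simp add: twisted_laplacian_def)

definition cover_verts :: "'v list \<Rightarrow> nat \<Rightarrow> ('v \<times> int) list" where
  "cover_verts vs N = map (\<lambda>(\<sigma>, v). (v, int \<sigma>)) (List.product [0..<N] vs)"

lemma length_cover_verts: "length (cover_verts vs N) = N * length vs"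
  by (simp add: cover_verts_def)

lemma cover_verts_nth:
  assumes "k < N * length vs"
  shows "cover_verts vs N ! k = (vs ! (k mod length vs), int (k div length vs))"
  using assms by (simp add: cover_verts_def product_nth less_mult_imp_div_less)

lemma distinct_cover_verts: "distinct vs \<Longrightarrow> distinct (cover_verts vs N)"
  unfolding cover_verts_def
  by (simp add: distinct_map distinct_product inj_on_def split_beta prod_eq_iff)

lemma set_cover_verts:
  assumes "set vs = verts G"
  shows "set (cover_verts vs N) = verts (derived_multigraph G (int N) S \<beta>)"
proof -
  have "set (cover_verts vs N) = set vs \<times> int ` {0..<N}" by (force simp: cover_verts_def)
  thus ?thesis using assms by (simp add: derived_multigraph_def image_int_atLeastLessThan)
qed

lemma (in fin_multigraph) laplacian_op_cong:
  assumes "\<And>w. w \<in> verts G \<Longrightarrow> x w = y w" and "u \<in> verts G"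
  shows "laplacian_op G x u = laplacian_op G y u"
  unfolding laplacian_op_def
  using assms terminus_in_verts by (intro sum.cong refl) auto

lemma derived_multigraph_1_indep: "derived_multigraph G 1 S \<beta> = derived_multigraph G 1 S \<beta>'"
  by (simp add: derived_multigraph_def)

locale oriented_multigraph = fin_multigraph G for G :: "('v, 'e) multigraph" +
  fixes S :: "'e set"
  assumes orientation: "is_orientation G S"
begin

lemma S_subset: "S \<subseteq> darts G"
  using orientation by (simp add: is_orientation_def)

lemma finite_S: "finite S"
  using S_subset finite_darts by (rule finite_subset)

lemma in_orientation_iff_opp_notin:
  assumes "e \<in> darts G"
  shows "e \<in> S \<longleftrightarrow> opp G e \<notin> S"
proof -
  have "\<exists>!s. s \<in> S \<and> s \<in> uedge G e"
    using orientation assms by (simp add: is_orientation_def uedges_def)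
  thus ?thesis using opp_neq[OF assms] unfolding uedge_def by blast
qed

lemma out_darts_eq_orientation:
  "out_darts G v = {s \<in> S. origin G s = v} \<union> opp G ` {s \<in> S. terminus G s = v}"
proof (intro equalityI subsetI)
  fix e assume e: "e \<in> out_darts G v"
  hence "e \<in> S \<or> opp G e \<in> S" using in_orientation_iff_opp_notin by blast
  moreover have "e = opp G (opp G e)" "terminus G (opp G e) = v"
    using e opp_opp[of e] inc_opp[of e] by auto
  ultimately show "e \<in> {s \<in> S. origin G s = v} \<union> opp G ` {s \<in> S. terminus G s = v}"
    using e by blast
next
  fix e assume "e \<in> {s \<in> S. origin G s = v} \<union> opp G ` {s \<in> S. terminus G s = v}"
  thus "e \<in> out_darts G v" using S_subset opp_in_darts inc_opp by auto
qed

lemma valency_orientation: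
  "valency G v = card {s \<in> S. origin G s = v} + card {s \<in> S. terminus G s = v}"
proof -
  have "opp G s \<notin> S" if "s \<in> S" for s
    using that S_subset in_orientation_iff_opp_notin by blast
  hence "{s \<in> S. origin G s = v} \<inter> opp G ` {s \<in> S. terminus G s = v} = {}" by blast
  moreover have "inj_on (opp G) {s \<in> S. terminus G s = v}"
    using S_subset opp_opp by (intro inj_on_inverseI[of _ "opp G"]) auto
  ultimately show ?thesis
    unfolding valency_def out_darts_eq_orientation using finite_S
    by (simp add: card_Un_disjoint card_image)
qed

lemma sum_out_darts_derived:
  fixes F :: "'v \<times> int \<Rightarrow> 'a::comm_monoid_add" and \<beta> :: "'e \<Rightarrow> int"
  assumes \<sigma>: "0 \<le> \<sigma>" "\<sigma> < m"
  defines "H \<equiv> derived_multigraph G m S \<beta>"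
  shows "(\<Sum>e\<in>out_darts H (v, \<sigma>). F (terminus H e))
    = (\<Sum>s\<in>{s \<in> S. origin G s = v}. F (terminus G s, (\<sigma> + \<beta> s) mod m)) +
      (\<Sum>s\<in>{s \<in> S. terminus G s = v}. F (origin G s, (\<sigma> - \<beta> s) mod m))"
proof -
  let ?out = "(\<lambda>s. (s, \<sigma>, True)) ` {s \<in> S. origin G s = v}"
    and ?in = "(\<lambda>s. (s, (\<sigma> - \<beta> s) mod m, False)) ` {s \<in> S. terminus G s = v}"
  have shift: "(\<rho> + b) mod m = \<sigma> \<longleftrightarrow> \<rho> = (\<sigma> - b) mod m" if "0 \<le> \<rho>" "\<rho> < m" for \<rho> b
  proof -
    have "(\<rho> + b) mod m = \<sigma> \<longleftrightarrow> (\<rho> + b) mod m = \<sigma> mod m" using \<sigma> by simp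
    also have "\<dots> \<longleftrightarrow> m dvd \<rho> - (\<sigma> - b)" by (simp add: mod_eq_dvd_iff algebra_simps)
    also have "\<dots> \<longleftrightarrow> \<rho> mod m = (\<sigma> - b) mod m" by (simp add: mod_eq_dvd_iff)
    finally show ?thesis using that by simp
  qed
  have "out_darts H (v, \<sigma>) = ?out \<union> ?in"
  proof (rule Set.set_eqI)
    fix e :: "'e \<times> int \<times> bool"
    obtain s \<rho> b where [simp]: "e = (s, \<rho>, b)" by (cases e)
    have "0 \<le> \<rho> \<and> \<rho> < m" if "\<rho> = (\<sigma> - \<beta> s) mod m" using that \<sigma> by simp
    thus "e \<in> out_darts H (v, \<sigma>) \<longleftrightarrow> e \<in> ?out \<union> ?in"
      using shift[of \<rho> "\<beta> s"] \<sigma>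
      by (cases b) (auto simp: H_def derived_multigraph_def Let_def)
  qed
  moreover have "?out \<inter> ?in = {}" by auto
  ultimately have "(\<Sum>e\<in>out_darts H (v, \<sigma>). F (terminus H e))
      = (\<Sum>e\<in>?out. F (terminus H e)) + (\<Sum>e\<in>?in. F (terminus H e))"
    using finite_S by (simp add: sum.union_disjoint)
  thus ?thesis by (simp add: sum.reindex inj_on_def H_def derived_multigraph_def Let_def)
qed

text \<open>On a function transforming by a character of the deck group, the cover looks like \<open>G\<close>.\<close>

lemma laplacian_op_derived_character:
  fixes \<xi> :: "'a::field"
  assumes \<sigma>: "0 \<le> \<sigma>" "\<sigma> < int N" and \<xi>: "\<xi> ^ N = 1"
  shows "laplacian_op (derived_multigraph G (int N) S \<beta>) (\<lambda>(w, \<tau>). y w * \<xi> powi \<tau>) (v, \<sigma>)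
    = \<xi> powi \<sigma> * (of_nat (valency G v) * y v -
        ((\<Sum>s\<in>{s \<in> S. origin G s = v}. y (terminus G s) * \<xi> powi \<beta> s) +
         (\<Sum>s\<in>{s \<in> S. terminus G s = v}. y (origin G s) * \<xi> powi (- \<beta> s))))"
proof -
  have "N > 0" using \<sigma> by simp
  hence "\<xi> \<noteq> 0" using \<xi> by (auto simp: power_0_left)
  hence shift: "\<xi> powi ((\<sigma> + b) mod int N) = \<xi> powi \<sigma> * \<xi> powi b" for b
    by (simp add: power_int_mod_exponent[OF \<xi>] power_int_add)
  have "laplacian_op (derived_multigraph G (int N) S \<beta>) (\<lambda>(w, \<tau>). y w * \<xi> powi \<tau>) (v, \<sigma>)
      = (\<Sum>s\<in>{s \<in> S. origin G s = v}.
          y v * \<xi> powi \<sigma> - y (terminus G s) * (\<xi> powi \<sigma> * \<xi> powi \<beta> s)) +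
        (\<Sum>s\<in>{s \<in> S. terminus G s = v}.
          y v * \<xi> powi \<sigma> - y (origin G s) * (\<xi> powi \<sigma> * \<xi> powi (- \<beta> s)))"
    unfolding laplacian_op_def
      sum_out_darts_derived[OF \<sigma>, where F = "\<lambda>w. (case (v, \<sigma>) of (w, \<tau>) \<Rightarrow> y w * \<xi> powi \<tau>) -
        (case w of (w, \<tau>) \<Rightarrow> y w * \<xi> powi \<tau>)"]
    using shift[of "- \<beta> s" for s] by (simp add: shift)
  thus ?thesis
    by (simp add: sum_subtractf sum_distrib_left valency_orientation algebra_simps)
qed

lemma laplacian_op_derived_twisted:
  fixes \<xi> :: "'a::field"
  assumes "0 \<le> \<sigma>" "\<sigma> < int N" "\<xi> ^ N = 1"
    and ij: "i < length vs" "j < length vs" and vs: "distinct vs"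
  shows "laplacian_op (derived_multigraph G (int N) S \<beta>)
      (\<lambda>(w, \<tau>). of_bool (w = vs ! j) * \<xi> powi \<tau>) (vs ! i, \<sigma>)
    = \<xi> powi \<sigma> * twisted_laplacian G vs S \<beta> \<xi> $$ (i, j)"
proof -
  have "(\<Sum>s\<in>{s \<in> S. origin G s = vs ! i}. of_bool (terminus G s = vs ! j) * \<xi> powi \<beta> s)
      = (\<Sum>s\<in>{s \<in> S. inc G s = (vs ! i, vs ! j)}. \<xi> powi \<beta> s)"
    using finite_S by (intro sum.mono_neutral_cong_right) (auto simp: prod_eq_iff)
  moreover have
    "(\<Sum>s\<in>{s \<in> S. terminus G s = vs ! i}. of_bool (origin G s = vs ! j) * \<xi> powi (- \<beta> s))
      = (\<Sum>s\<in>{s \<in> S. inc G s = (vs ! j, vs ! i)}. \<xi> powi (- \<beta> s))"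
    using finite_S by (intro sum.mono_neutral_cong_right) (auto simp: prod_eq_iff)
  ultimately show ?thesis
    using ij vs
    by (simp add: laplacian_op_derived_character[OF assms(1-3)] twisted_laplacian_def
        nth_eq_iff_index_eq)
qed

context
  fixes vs :: "'v list"
  assumes vs: "distinct vs" "set vs = verts G"
begin

lemma fin_multigraph_derived: "N > 0 \<Longrightarrow> fin_multigraph (derived_multigraph G (int N) S \<beta>)"
  by (intro fin_multigraph.intro finite_multigraph_derived finite_G S_subset) simp

lemma laplacian_op_derived_fourier:
  fixes \<zeta> :: "'a::field" and \<beta> :: "'e \<Rightarrow> int"
  assumes \<zeta>: "\<zeta> ^ N = 1" and bounds: "\<sigma> < N" "i < length vs" "j < length vs"
  defines "H \<equiv> derived_multigraph G (int N) S \<beta>"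
  shows "(\<Sum>\<tau><N. laplacian_op H (\<lambda>w. of_bool (w = (vs ! j, int \<tau>))) (vs ! i, int \<sigma>) * \<zeta> ^ (\<tau> * t))
    = \<zeta> ^ (\<sigma> * t) * twisted_laplacian G vs S \<beta> (\<zeta> ^ t) $$ (i, j)"
proof -
  interpret cover: fin_multigraph H
    unfolding H_def using bounds(1) by (intro fin_multigraph_derived) simp
  let ?x = "\<lambda>w :: 'v \<times> int. \<Sum>\<tau><N. of_bool (w = (vs ! j, int \<tau>)) * \<zeta> ^ (\<tau> * t)"
  have "(\<Sum>\<tau><N. laplacian_op H (\<lambda>w. of_bool (w = (vs ! j, int \<tau>))) (vs ! i, int \<sigma>) * \<zeta> ^ (\<tau> * t))
      = laplacian_op H ?x (vs ! i, int \<sigma>)"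
    by (rule laplacian_op_sum[symmetric])
  also have "\<dots> = laplacian_op H
      (\<lambda>(w, \<tau>). of_bool (w = vs ! j) * (\<zeta> ^ t) powi \<tau>) (vs ! i, int \<sigma>)"
  proof (rule cover.laplacian_op_cong)
    show "(vs ! i, int \<sigma>) \<in> verts H"
      using bounds vs(2) nth_mem by (auto simp: H_def derived_multigraph_def)
    fix w assume "w \<in> verts H"
    then obtain u \<rho> where w: "w = (u, int \<rho>)" and "\<rho> < N"
      by (auto simp: H_def derived_multigraph_def dest!: zero_le_imp_eq_int)
    have "?x w = (\<Sum>\<tau><N. if \<tau> = \<rho> then of_bool (u = vs ! j) * \<zeta> ^ (\<rho> * t) else 0)"
      unfolding w by (intro sum.cong refl) auto
    thus "?x w = (case w of (w, \<tau>) \<Rightarrow> of_bool (w = vs ! j) * (\<zeta> ^ t) powi \<tau>)"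
      using \<open>\<rho> < N\<close> by (simp add: w mult.commute flip: power_mult)
  qed
  also have "\<dots> = (\<zeta> ^ t) powi int \<sigma> * twisted_laplacian G vs S \<beta> (\<zeta> ^ t) $$ (i, j)"
    unfolding H_def using bounds vs(1)
    by (intro laplacian_op_derived_twisted power_of_root_of_unity[OF \<zeta>]) auto
  finally show ?thesis by (simp add: mult.commute flip: power_mult)
qed

lemma char_poly_laplacian_derived:
  fixes \<zeta> :: "'a::field"
  assumes N: "of_nat N \<noteq> (0 :: 'a)" and \<zeta>: "primitive_root_of_unity N \<zeta>"
  shows "char_poly (laplacian_matrix (derived_multigraph G (int N) S \<beta>) (cover_verts vs N))
    = (\<Prod>t<N. char_poly (twisted_laplacian G vs S \<beta> (\<zeta> ^ t)))"
proof -
  let ?H = "derived_multigraph G (int N) S \<beta>"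
  define a :: "nat \<Rightarrow> nat \<Rightarrow> nat \<Rightarrow> nat \<Rightarrow> 'a" where
    "a \<sigma> \<tau> i j = laplacian_op ?H (\<lambda>w. of_bool (w = (vs ! j, int \<tau>))) (vs ! i, int \<sigma>)" for \<sigma> \<tau> i j
  have "laplacian_matrix ?H (cover_verts vs N) = block_mat (length vs) N a"
    unfolding laplacian_matrix_def block_mat_def length_cover_verts
    by (intro eq_matI) (simp_all add: cover_verts_nth a_def)
  moreover have "\<zeta> ^ N = 1" using \<zeta> by (rule primitive_root_power_self)
  ultimately show ?thesis
    by (simp add: char_poly_block_fourier[OF N \<zeta> twisted_laplacian_carrier] a_def
        laplacian_op_derived_fourier)
qed

lemma char_poly_twisted_laplacian_1:
  "char_poly (twisted_laplacian G vs S \<beta> (1 :: 'a::field))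
    = char_poly (laplacian_matrix (derived_multigraph G 1 S \<beta>) (cover_verts vs 1))"
proof -
  have "primitive_root_of_unity 1 (1 :: 'a)" by (auto simp: primitive_root_of_unity_def)
  thus ?thesis using char_poly_laplacian_derived[of 1 "1 :: 'a" \<beta>] by simp
qed

lemma poly_char_poly_twisted_laplacian_1:
  assumes "vs \<noteq> []"
  shows "poly (char_poly (twisted_laplacian G vs S \<beta> (1 :: 'a::field))) 0 = 0"
proof -
  interpret cover: fin_multigraph "derived_multigraph G (int 1) S \<beta>"
    by (rule fin_multigraph_derived) simp
  have "verts (derived_multigraph G (int 1) S \<beta>) \<noteq> {}"
    using assms vs(2) by (auto simp: derived_multigraph_def)
  hence "det (laplacian_matrix (derived_multigraph G (int 1) S \<beta>) (cover_verts vs 1) :: 'a mat) = 0"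
    using vs by (intro cover.det_laplacian_matrix_verts distinct_cover_verts set_cover_verts)
  thus ?thesis
    unfolding char_poly_twisted_laplacian_1 poly_char_poly_0[OF laplacian_matrix_carrier] by simp
qed

lemma pderiv_char_poly_laplacian_derived:
  assumes "N > 0"
  shows "poly (pderiv (char_poly
      (laplacian_matrix (derived_multigraph G (int N) S \<beta>) (cover_verts vs N)))) 0
    = ((- 1) ^ (N * length vs - 1) * of_nat
        (N * length vs * card (spanning_trees (derived_multigraph G (int N) S \<beta>))) :: 'a::idom)"
proof -
  interpret cover: fin_multigraph "derived_multigraph G (int N) S \<beta>"
    using assms by (rule fin_multigraph_derived)
  show ?thesis
    using cover.pderiv_char_poly_laplacian_matrix[where 'a = 'a] vs
    by (simp add: length_cover_verts distinct_cover_verts set_cover_verts)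
qed

text \<open>
  Compare the linear coefficients of the characteristic polynomials: the factor at the trivial
  character belongs to the Laplacian of \<open>G\<close> and vanishes at 0, the other factors contribute their
  determinants.
\<close>

theorem card_spanning_trees_derived:
  fixes \<zeta> :: "'a::field"
  assumes nonzero: "of_nat (length vs * N) \<noteq> (0 :: 'a)" and \<zeta>: "primitive_root_of_unity N \<zeta>"
  shows "of_nat (N * card (spanning_trees (derived_multigraph G (int N) S \<beta>)))
    = of_nat (card (spanning_trees (derived_multigraph G 1 S \<beta>))) *
      (\<Prod>t\<in>{1..<N}. det (twisted_laplacian G vs S \<beta> (\<zeta> ^ t)))"
proof -
  let ?g = "length vs" and ?H = "\<lambda>M. derived_multigraph G (int M) S \<beta>"
  let ?\<kappa> = "\<lambda>M. card (spanning_trees (?H M))"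
  define T where "T t = twisted_laplacian G vs S \<beta> (\<zeta> ^ t)" for t
  have N: "of_nat N \<noteq> (0 :: 'a)" "N > 0" and nonempty: "vs \<noteq> []"
    using nonzero by (auto intro: Nat.gr0I)
  have "(- 1) ^ (N * ?g - 1) * of_nat (N * ?g * ?\<kappa> N)
      = poly (pderiv (char_poly (laplacian_matrix (?H N) (cover_verts vs N) :: 'a mat))) 0"
    by (rule pderiv_char_poly_laplacian_derived[OF N(2), symmetric])
  also have "\<dots> = poly (pderiv (\<Prod>t<N. char_poly (T t))) 0"
    unfolding T_def by (simp add: char_poly_laplacian_derived[OF N(1) \<zeta>])
  also have "{..<N} = insert 0 {1..<N}" using N(2) by auto
  also have "poly (pderiv (\<Prod>t\<in>insert 0 {1..<N}. char_poly (T t))) 0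
      = poly (pderiv (char_poly (T 0))) 0 * (\<Prod>t\<in>{1..<N}. poly (char_poly (T t)) 0)"
    using poly_char_poly_twisted_laplacian_1[OF nonempty, of \<beta>, where 'a = 'a]
    by (simp add: pderiv_mult T_def poly_prod)
  also have "\<dots> = (- 1) ^ (?g - 1) * of_nat (?g * ?\<kappa> 1) * (\<Prod>t\<in>{1..<N}. (- 1) ^ ?g * det (T t))"
    using pderiv_char_poly_laplacian_derived[of 1 \<beta>, where 'a = 'a]
    by (simp add: T_def char_poly_twisted_laplacian_1
        poly_char_poly_0[OF twisted_laplacian_carrier])
  also have "\<dots> = (- 1) ^ (?g - 1 + ?g * (N - 1)) * of_nat (?g * ?\<kappa> 1) * (\<Prod>t\<in>{1..<N}. det (T t))"
    by (simp add: prod.distrib power_add power_mult)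
  also have "?g - 1 + ?g * (N - 1) = N * ?g - 1"
    using N(2) nonempty by (cases N; cases vs) (auto simp: algebra_simps)
  finally have "of_nat ?g * of_nat (N * ?\<kappa> N)
      = of_nat ?g * (of_nat (?\<kappa> 1) * (\<Prod>t\<in>{1..<N}. det (T t)))"
    by (simp add: algebra_simps)
  thus ?thesis using nonzero by (simp add: T_def)
qed

end

end

section \<open>Evaluation of generalized polynomials\<close>

lemma padic_power_add:
  fixes a b :: "'l::prime_card padic_int" and \<xi> :: "'a::monoid_mult"
  assumes "\<xi> ^ (CARD('l) ^ m) = 1"
  shows "padic_power \<xi> (a + b) = padic_power \<xi> a * padic_power \<xi> b"
proof -
  have "nat (padic_red m (a + b))
      = (nat (padic_red m a) + nat (padic_red m b)) mod CARD('l) ^ m"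
    using padic_red_range(1)[of m a] padic_red_range(1)[of m b]
    by (simp add: padic_red_add nat_mod_distrib nat_power_eq nat_add_distrib)
  thus ?thesis
    by (simp add: padic_power_eq[OF assms] power_mod_exponent[OF assms] flip: power_add)
qed

lemma padic_power_power:
  fixes a :: "'l::prime_card padic_int" and \<xi> :: "'a::monoid_mult"
  assumes "\<xi> ^ (CARD('l) ^ m) = 1"
  shows "padic_power (\<xi> ^ u) a = padic_power \<xi> a ^ u"
  unfolding padic_power_eq[OF assms] padic_power_eq[OF power_of_root_of_unity[OF assms]]
  by (simp add: mult.commute flip: power_mult)

lemma padic_power_root_of_unity:
  fixes a :: "'l::prime_card padic_int" and \<xi> :: "'a::monoid_mult"
  assumes "\<xi> ^ (CARD('l) ^ m) = 1"
  shows "padic_power \<xi> a ^ (CARD('l) ^ m) = 1"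
  unfolding padic_power_eq[OF assms] by (rule power_of_root_of_unity[OF assms])

lemma gp_eval_eq_sum:
  assumes "finite A" "Poly_Mapping.keys P \<subseteq> A"
  shows "gp_eval P \<xi> = (\<Sum>a\<in>A. of_int (Poly_Mapping.lookup P a) * padic_power \<xi> a)"
  unfolding gp_eval_def using assms by (intro sum.mono_neutral_left) (auto simp: in_keys_iff)

lemma gp_eval_add: "gp_eval (P + Q) \<xi> = gp_eval P \<xi> + gp_eval Q \<xi>"
proof -
  let ?A = "Poly_Mapping.keys P \<union> Poly_Mapping.keys Q"
  have "gp_eval (P + Q) \<xi> = (\<Sum>a\<in>?A. of_int (Poly_Mapping.lookup (P + Q) a) * padic_power \<xi> a)"
    by (intro gp_eval_eq_sum) (auto dest: subsetD[OF Poly_Mapping.keys_add])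
  also have "\<dots> = gp_eval P \<xi> + gp_eval Q \<xi>"
    by (subst (1 2) gp_eval_eq_sum[of ?A]) (auto simp: lookup_add algebra_simps sum.distrib)
  finally show ?thesis .
qed

lemma gp_eval_0: "gp_eval 0 \<xi> = 0"
  by (simp add: gp_eval_def)

lemma gp_eval_sum: "gp_eval (\<Sum>i\<in>I. P i) \<xi> = (\<Sum>i\<in>I. gp_eval (P i) \<xi>)"
  by (induction I rule: infinite_finite_induct) (auto simp: gp_eval_add gp_eval_0)

lemma gp_eval_single: "gp_eval (Poly_Mapping.single a c) \<xi> = of_int c * padic_power \<xi> a"
  by (subst gp_eval_eq_sum[of "{a}"]) (auto simp: lookup_single)

lemma gp_eval_T_pow: "gp_eval (gp_T_pow a) \<xi> = padic_power \<xi> a"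
  by (simp add: gp_T_pow_def gp_eval_single)

lemma poly_mapping_eq_sum_single:
  "P = (\<Sum>a\<in>Poly_Mapping.keys P. Poly_Mapping.single a (Poly_Mapping.lookup P a))"
  by (rule poly_mapping_eqI) (simp add: lookup_sum lookup_single when_def in_keys_iff)

lemma gp_eval_mult:
  fixes P Q :: "('l::prime_card, int) gen_poly" and \<xi> :: "'a::comm_ring_1"
  assumes "\<xi> ^ (CARD('l) ^ m) = 1"
  shows "gp_eval (P * Q) \<xi> = gp_eval P \<xi> * gp_eval Q \<xi>"
proof -
  let ?p = "Poly_Mapping.lookup P" and ?q = "Poly_Mapping.lookup Q"
  let ?K = "Poly_Mapping.keys P" and ?L = "Poly_Mapping.keys Q"
  have "P * Q = (\<Sum>a\<in>?K. \<Sum>b\<in>?L. Poly_Mapping.single (a + b) (?p a * ?q b))"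
    by (subst (1) poly_mapping_eq_sum_single[of P], subst (1) poly_mapping_eq_sum_single[of Q])
       (simp add: sum_product Poly_Mapping.mult_single)
  hence "gp_eval (P * Q) \<xi>
      = (\<Sum>a\<in>?K. \<Sum>b\<in>?L. of_int (?p a * ?q b) * padic_power \<xi> (a + b))"
    by (simp add: gp_eval_sum gp_eval_single)
  also have "\<dots> = gp_eval P \<xi> * gp_eval Q \<xi>"
    by (simp add: gp_eval_def sum_product padic_power_add[OF assms] algebra_simps)
  finally show ?thesis .
qed

lemma comm_ring_hom_gp_eval:
  fixes \<xi> :: "'a::comm_ring_1"
  assumes "\<xi> ^ (CARD('l) ^ m) = 1"
  shows "comm_ring_hom (\<lambda>P :: ('l::prime_card, int) gen_poly. gp_eval P \<xi>)"
proof
  have "gp_eval (1 :: ('l, int) gen_poly) \<xi> = padic_power \<xi> (0 :: 'l padic_int)"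
    using gp_eval_single[of 0 1 \<xi>] by (simp add: single_one)
  also have "\<dots> = 1" by (simp add: padic_power_eq[OF assms] padic_red_0)
  finally show "gp_eval (1 :: ('l, int) gen_poly) \<xi> = 1" .
qed (simp_all add: gp_eval_add gp_eval_0 gp_eval_mult[OF assms])

lemma gp_eval_of_nat_mult:
  fixes P :: "('l::prime_card, int) gen_poly" and \<xi> :: "'a::comm_ring_1"
  assumes "\<xi> ^ (CARD('l) ^ m) = 1"
  shows "gp_eval (of_nat k * P) \<xi> = of_nat k * gp_eval P \<xi>"
proof -
  interpret comm_ring_hom "\<lambda>P :: ('l, int) gen_poly. gp_eval P \<xi>"
    by (rule comm_ring_hom_gp_eval[OF assms])
  show ?thesis by (simp only: hom_mult hom_of_nat)
qed

lemma gp_eval_voltage_matrix: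
  fixes \<alpha> :: "'e \<Rightarrow> 'l::prime_card padic_int" and \<xi> :: "'a::field"
  assumes \<xi>: "\<xi> ^ (CARD('l) ^ n) = 1"
  shows "map_mat (\<lambda>P. gp_eval P \<xi>) (voltage_matrix G vs S \<alpha>)
    = twisted_laplacian G vs S (\<lambda>s. padic_red n (\<alpha> s)) \<xi>"
proof -
  interpret comm_ring_hom "\<lambda>P :: ('l, int) gen_poly. gp_eval P \<xi>"
    by (rule comm_ring_hom_gp_eval[OF \<xi>])
  have "\<xi> \<noteq> 0" using \<xi> by (auto simp: power_0_left)
  have "padic_power \<xi> a = \<xi> powi padic_red n a" for a :: "'l padic_int"
    using padic_red_range(1)[of n a] by (simp add: padic_power_eq[OF \<xi>] power_int_nonneg_exp)
  moreover have "\<xi> powi padic_red n (- a) = \<xi> powi (- padic_red n a)" for a :: "'l padic_int"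
    using power_int_mod_exponent[OF \<xi> \<open>\<xi> \<noteq> 0\<close>, of "- padic_red n a"]
    by (simp add: padic_red_uminus)
  ultimately show ?thesis
    by (intro eq_matI) (auto simp: voltage_matrix_def twisted_laplacian_def hom_minus hom_add
        hom_of_nat gp_eval_sum gp_eval_T_pow)
qed

lemma gp_eval_det_voltage_matrix:
  fixes \<alpha> :: "'e \<Rightarrow> 'l::prime_card padic_int" and \<xi> :: "'a::field"
  assumes \<xi>: "\<xi> ^ (CARD('l) ^ n) = 1"
  shows "gp_eval (det (voltage_matrix G vs S \<alpha>)) \<xi>
    = det (twisted_laplacian G vs S (\<lambda>s. padic_red n (\<alpha> s)) \<xi>)"
  using comm_ring_hom.hom_det[OF comm_ring_hom_gp_eval[OF \<xi>]]
  by (simp flip: gp_eval_voltage_matrix[OF \<xi>])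

section \<open>Spanning trees in the tower\<close>

lemma primitive_root_power_dvd:
  assumes "primitive_root_of_unity (d * N) \<zeta>" and "d > 0"
  shows "primitive_root_of_unity N (\<zeta> ^ d)"
  unfolding primitive_root_of_unity_def power_mult[symmetric]
  using assms by (simp add: primitive_root_of_unity_def)

lemma (in oriented_multigraph) card_spanning_trees_tower:
  fixes \<alpha> :: "'e \<Rightarrow> 'l::prime_card padic_int" and \<zeta> :: "'a::field"
  assumes vs: "distinct vs" "set vs = verts G"
    and nonzero: "of_nat (length vs * CARD('l) ^ n) \<noteq> (0 :: 'a)"
    and \<zeta>: "primitive_root_of_unity (CARD('l) ^ n) \<zeta>"
  shows "of_nat (CARD('l) ^ n * card (spanning_trees (tower_layer G S \<alpha> n)))
    = of_nat (card (spanning_trees (tower_layer G S \<alpha> 0))) *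
      (\<Prod>t\<in>{1..<CARD('l) ^ n}. gp_eval (det (voltage_matrix G vs S \<alpha>)) (\<zeta> ^ t))"
proof -
  let ?\<beta> = "\<lambda>s. padic_red n (\<alpha> s)"
  have "\<zeta> ^ (CARD('l) ^ n) = 1" using \<zeta> by (rule primitive_root_power_self)
  hence "gp_eval (det (voltage_matrix G vs S \<alpha>)) (\<zeta> ^ t)
      = det (twisted_laplacian G vs S ?\<beta> (\<zeta> ^ t))" for t
    by (intro gp_eval_det_voltage_matrix power_of_root_of_unity)
  moreover have "tower_layer G S \<alpha> 0 = derived_multigraph G 1 S ?\<beta>"
    using derived_multigraph_1_indep[of G S "\<lambda>s. padic_red 0 (\<alpha> s)" ?\<beta>]
    by (simp add: tower_layer_def)
  ultimately show ?thesis
    using card_spanning_trees_derived[OF vs nonzero \<zeta>, of ?\<beta>] by (simp add: tower_layer_def)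
qed

lemma atLeastLessThan_prime_power_Suc:
  assumes "prime l"
  shows "{1..<l ^ Suc n} = (*) l ` {1..<l ^ n} \<union> totatives (l ^ Suc n)"
    and "(*) l ` {1..<l ^ n} \<inter> totatives (l ^ Suc n) = {}"
proof -
  have l: "l > 0" using assms prime_gt_0_nat by blast
  have last: "{0<..m} = insert m {1..<m}" if "m > 0" for m :: nat using that by auto
  have sub: "(*) l ` {1..<l ^ n} \<subseteq> {1..<l ^ Suc n}" using l by auto
  have "totatives (l ^ Suc n) = {0<..l ^ Suc n} - (*) l ` {0<..l ^ n}"
    by (rule totatives_prime_power_Suc[OF assms])
  also have "\<dots> = insert (l ^ Suc n) {1..<l ^ Suc n} - insert (l ^ Suc n) ((*) l ` {1..<l ^ n})"
    using l last[of "l ^ n"] last[of "l ^ Suc n"] by simp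
  also have "\<dots> = {1..<l ^ Suc n} - (*) l ` {1..<l ^ n}" by force
  finally have totatives: "totatives (l ^ Suc n) = {1..<l ^ Suc n} - (*) l ` {1..<l ^ n}" .
  show "{1..<l ^ Suc n} = (*) l ` {1..<l ^ n} \<union> totatives (l ^ Suc n)"
    and "(*) l ` {1..<l ^ n} \<inter> totatives (l ^ Suc n) = {}"
    unfolding totatives using sub by blast+
qed

theorem (in oriented_multigraph) card_spanning_trees_tower_Suc:
  fixes \<alpha> :: "'e \<Rightarrow> 'l::prime_card padic_int" and \<zeta> :: "'a::field"
  assumes vs: "distinct vs" "set vs = verts G"
    and nonzero: "of_nat (length vs * CARD('l)) \<noteq> (0 :: 'a)"
    and \<zeta>: "primitive_root_of_unity (CARD('l) ^ Suc n) \<zeta>"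
  shows "of_nat (CARD('l) * card (spanning_trees (tower_layer G S \<alpha> (Suc n))))
    = of_nat (card (spanning_trees (tower_layer G S \<alpha> n))) *
      (\<Prod>t\<in>totatives (CARD('l) ^ Suc n). gp_eval (det (voltage_matrix G vs S \<alpha>)) (\<zeta> ^ t))"
proof -
  let ?l = "CARD('l)" and ?\<kappa> = "\<lambda>n. card (spanning_trees (tower_layer G S \<alpha> n))"
  let ?F = "gp_eval (det (voltage_matrix G vs S \<alpha>))"
  have l: "prime ?l" by (rule prime_card)
  have nonzero': "of_nat (length vs * ?l ^ m) \<noteq> (0 :: 'a)" for m using nonzero by simp
  have \<zeta>l: "primitive_root_of_unity (?l ^ n) (\<zeta> ^ ?l)"
    using \<zeta> by (intro primitive_root_power_dvd) simp_all
  have "(\<Prod>t\<in>{1..<?l ^ Suc n}. ?F (\<zeta> ^ t))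
      = (\<Prod>t\<in>(*) ?l ` {1..<?l ^ n}. ?F (\<zeta> ^ t)) * (\<Prod>t\<in>totatives (?l ^ Suc n). ?F (\<zeta> ^ t))"
    unfolding atLeastLessThan_prime_power_Suc(1)[OF l]
    by (intro prod.union_disjoint atLeastLessThan_prime_power_Suc(2) l) auto
  also have "(\<Prod>t\<in>(*) ?l ` {1..<?l ^ n}. ?F (\<zeta> ^ t)) = (\<Prod>t\<in>{1..<?l ^ n}. ?F ((\<zeta> ^ ?l) ^ t))"
    by (simp add: prod.reindex inj_on_def power_mult)
  finally have "of_nat (?l ^ Suc n * ?\<kappa> (Suc n)) = of_nat (?l ^ n * ?\<kappa> n) *
      (\<Prod>t\<in>totatives (?l ^ Suc n). ?F (\<zeta> ^ t))"
    using card_spanning_trees_tower[OF vs nonzero' \<zeta>, of \<alpha>]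
      card_spanning_trees_tower[OF vs nonzero' \<zeta>l, of \<alpha>]
    by (simp only: mult.assoc)
  hence "of_nat (?l ^ n) * of_nat (?l * ?\<kappa> (Suc n))
      = of_nat (?l ^ n) * (of_nat (?\<kappa> n) * (\<Prod>t\<in>totatives (?l ^ Suc n). ?F (\<zeta> ^ t)))"
    by (simp add: mult_ac)
  moreover have "of_nat (?l ^ n) \<noteq> (0 :: 'a)" using nonzero'[of n] by simp
  ultimately show ?thesis by (metis mult_cancel_left)
qed

section \<open>Powers of an integer modulo prime powers\<close>

lemma cong_sum_powers:
  fixes q :: int
  assumes "[q = 1] (mod m)"
  shows "[(\<Sum>i<n. q ^ i) = int n] (mod m)"
proof -
  have "[(\<Sum>i<n. q ^ i) = (\<Sum>i<n. 1 ^ i)] (mod m)" using assms by (intro cong_sum cong_pow)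
  thus ?thesis by simp
qed

lemma multiplicity_sum_powers:
  fixes q :: int
  assumes l: "prime l" and q: "[q = 1] (mod int l ^ 2)" and n: "n = l \<or> \<not> l dvd n"
  shows "multiplicity (int l) (\<Sum>i<n. q ^ i) = multiplicity l n"
proof -
  obtain w where w: "(\<Sum>i<n. q ^ i) = int n + int l ^ 2 * w"
    using cong_sum_powers[OF q, of n] by (metis cong_iff_lin cong_sym)
  from n show ?thesis
  proof
    assume "n = l"
    hence "(\<Sum>i<n. q ^ i) = int l ^ 1 * (1 + int l * w)"
      unfolding w by (simp add: power2_eq_square algebra_simps)
    moreover have "\<not> int l dvd 1 + int l * w"
      using l by (auto simp: dvd_add_left_iff dest: prime_gt_1_nat)
    ultimately show ?thesis using l \<open>n = l\<close> by (auto intro!: multiplicity_eqI)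
  next
    assume "\<not> l dvd n"
    moreover hence "\<not> int l dvd (\<Sum>i<n. q ^ i)"
      unfolding w by (simp add: dvd_add_left_iff power2_eq_square)
    ultimately show ?thesis by (simp add: not_dvd_imp_multiplicity_0)
  qed
qed

lemma lifting_the_exponent:
  fixes q :: int
  assumes l: "prime l" and q: "[q = 1] (mod int l ^ 2)" "q > 1" and "n > 0"
  shows "multiplicity (int l) (q ^ n - 1) = multiplicity (int l) (q - 1) + multiplicity l n"
  using \<open>n > 0\<close>
proof (induction n rule: less_induct)
  case (less n)
  have factor: "multiplicity (int l) (x ^ k - 1) = multiplicity (int l) (x - 1) + multiplicity l k"
    if x: "[x = 1] (mod int l ^ 2)" "x > 1" and k: "k = l \<or> \<not> l dvd k" "k > 0" for x :: int and k
  proof -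
    have "(\<Sum>i<k. x ^ i) > 0" using x k by (intro sum_pos) auto
    hence "multiplicity (int l) ((x - 1) * (\<Sum>i<k. x ^ i))
        = multiplicity (int l) (x - 1) + multiplicity (int l) (\<Sum>i<k. x ^ i)"
      using x l by (intro prime_elem_multiplicity_mult_distrib) auto
    thus ?thesis by (simp add: power_diff_1_eq multiplicity_sum_powers[OF l x(1) k(1)])
  qed
  show ?case
  proof (cases "l dvd n")
    case True
    then obtain m where m: "n = l * m" by blast
    with less.prems l have "m > 0" "m < n" by (auto dest: prime_gt_1_nat)
    have "q ^ n - 1 = (q ^ m) ^ l - 1" by (simp add: m mult.commute flip: power_mult)
    also have "multiplicity (int l) \<dots> = multiplicity (int l) (q ^ m - 1) + multiplicity l l"
      using q \<open>m > 0\<close> l cong_pow[OF q(1), of m] by (intro factor) (auto dest: prime_gt_0_nat)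
    also have "\<dots> = multiplicity (int l) (q - 1) + (multiplicity l l + multiplicity l m)"
      using less.IH[OF \<open>m < n\<close> \<open>m > 0\<close>] by simp
    also have "multiplicity l l + multiplicity l m = multiplicity l n"
      using l \<open>m > 0\<close> unfolding m by (subst prime_elem_multiplicity_mult_distrib) auto
    finally show ?thesis .
  next
    case False
    thus ?thesis using factor q less.prems by blast
  qed
qed

lemma ord_prime_power:
  fixes q :: nat
  assumes l: "prime l" and q: "[q = 1] (mod l ^ 2)" "q > 1"
  shows "ord (l ^ i) q = l ^ (i - multiplicity (int l) (int q - 1))"
proof -
  let ?c = "multiplicity (int l) (int q - 1)"
  have q': "[int q = 1] (mod int l ^ 2)" using q(1) by (metis cong_int_iff of_nat_1 of_nat_power)
  have "ord (l ^ i) q dvd d \<longleftrightarrow> l ^ (i - ?c) dvd d" if "d > 0" for d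
  proof -
    have "ord (l ^ i) q dvd d \<longleftrightarrow> [q ^ d = 1] (mod l ^ i)" by (rule ord_divides[symmetric])
    also have "\<dots> \<longleftrightarrow> [int q ^ d = 1] (mod int l ^ i)" by (metis cong_int_iff of_nat_1 of_nat_power)
    also have "\<dots> \<longleftrightarrow> int l ^ i dvd int q ^ d - 1" by (rule cong_iff_dvd_diff)
    also have "\<dots> \<longleftrightarrow> i \<le> multiplicity (int l) (int q ^ d - 1)"
    proof (rule power_dvd_iff_le_multiplicity)
      have "1 < int q ^ d" using q(2) that by (intro one_less_power) auto
      thus "int q ^ d - 1 \<noteq> 0" by simp
      show "\<not> is_unit (int l)" using l by (auto dest: prime_gt_1_nat)
    qed
    also have "\<dots> \<longleftrightarrow> i - ?c \<le> multiplicity l d"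
      using q(2) by (simp add: lifting_the_exponent[OF l q' _ that] le_diff_conv add.commute)
    also have "\<dots> \<longleftrightarrow> l ^ (i - ?c) dvd d"
      using that l by (intro power_dvd_iff_le_multiplicity[symmetric]) auto
    finally show ?thesis .
  qed
  moreover have "l ^ (i - ?c) > 0" using l prime_gt_0_nat by simp
  moreover have "ord (l ^ i) q > 0"
  proof -
    have "coprime q (l ^ 2)" using q(1) cong_imp_coprime cong_sym by (metis coprime_1_left)
    hence "coprime (l ^ i) q" by (simp add: coprime_commute)
    thus ?thesis by (simp add: ord_eq_0 Nat.gr0I)
  qed
  ultimately show ?thesis by (meson dvd_antisym dvd_refl)
qed

text \<open>Both sides have \<open>l^(i - c)\<close> elements, the left one because this is the order of \<open>q\<close>.\<close>

lemma powers_eq_principal_units: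
  fixes q :: nat
  assumes l: "prime l" and q: "[q = 1] (mod l ^ 2)" "q > 1"
    and c: "c = multiplicity (int l) (int q - 1)" "c \<le> i"
  shows "(\<lambda>k. q ^ k mod l ^ i) ` {..<l ^ (i - c)} = (\<lambda>t. 1 + l ^ c * t) ` {..<l ^ (i - c)}"
proof (rule card_subset_eq)
  have l1: "l > 1" using l prime_gt_1_nat by blast
  have split: "l ^ i = l ^ c * l ^ (i - c)" using c(2) by (simp flip: power_add)
  have "int l ^ 2 dvd int q - 1"
    using q(1) by (metis cong_iff_dvd_diff cong_int_iff of_nat_1 of_nat_power)
  hence "2 \<le> c" unfolding c(1) using l1 q(2) by (intro multiplicity_geI) auto
  hence "1 < l ^ c" using l1 by (intro one_less_power) auto
  have "[q = 1] (mod l ^ c)"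
  proof -
    have "int l ^ c dvd int q - 1" unfolding c(1) by (rule multiplicity_dvd)
    thus ?thesis by (metis cong_iff_dvd_diff cong_int_iff of_nat_1 of_nat_power)
  qed
  have residue: "q ^ k mod l ^ i mod l ^ c = 1" for k
  proof -
    have "q ^ k mod l ^ i mod l ^ c = q ^ k mod l ^ c" by (simp add: split mod_mod_cancel)
    also have "\<dots> = 1 ^ k mod l ^ c"
      using cong_pow[OF \<open>[q = 1] (mod l ^ c)\<close>] by (simp only: cong_def)
    also have "\<dots> = 1" using \<open>1 < l ^ c\<close> by (simp only: power_one mod_less)
    finally show ?thesis .
  qed
  show "(\<lambda>k. q ^ k mod l ^ i) ` {..<l ^ (i - c)} \<subseteq> (\<lambda>t. 1 + l ^ c * t) ` {..<l ^ (i - c)}"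
  proof (rule image_subsetI)
    fix k
    have "q ^ k mod l ^ i < l ^ c * l ^ (i - c)" unfolding split[symmetric] using l1 by simp
    hence "q ^ k mod l ^ i div l ^ c \<in> {..<l ^ (i - c)}"
      by (simp add: less_mult_imp_div_less mult.commute)
    moreover have "q ^ k mod l ^ i = 1 + l ^ c * (q ^ k mod l ^ i div l ^ c)"
      using residue[of k] mult_div_mod_eq[of "l ^ c" "q ^ k mod l ^ i"] by simp
    ultimately show "q ^ k mod l ^ i \<in> (\<lambda>t. 1 + l ^ c * t) ` {..<l ^ (i - c)}" by blast
  qed
  have "coprime q (l ^ 2)" using q(1) cong_imp_coprime cong_sym by (metis coprime_1_left)
  hence "coprime (l ^ i) q" by (simp add: coprime_commute)
  hence "inj_on (\<lambda>k. q ^ k mod l ^ i) {..<l ^ (i - c)}"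
    using inj_power_mod[of "l ^ i" q] by (simp add: ord_prime_power[OF l q] c(1))
  moreover have "inj_on (\<lambda>t. 1 + l ^ c * t) {..<l ^ (i - c)}" using l1 by (simp add: inj_on_def)
  ultimately show "card ((\<lambda>k. q ^ k mod l ^ i) ` {..<l ^ (i - c)})
      = card ((\<lambda>t. 1 + l ^ c * t) ` {..<l ^ (i - c)})"
    by (simp add: card_image)
qed simp

lemma principal_units_are_powers:
  fixes l p :: nat
  assumes l: "prime l" and p: "p > 1" "coprime p l"
  obtains c where "\<And>i t. c \<le> i \<Longrightarrow> t < l ^ (i - c) \<Longrightarrow> \<exists>k. [p ^ k = 1 + l ^ c * t] (mod l ^ i)"
proof -
  let ?q = "p ^ totient (l ^ 2)"
  have q: "[?q = 1] (mod l ^ 2)" by (rule euler_theorem) (use p in simp)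
  have "l > 0" using l prime_gt_0_nat by blast
  hence "?q > 1" using p(1) by (intro one_less_power) auto
  define c where "c = multiplicity (int l) (int ?q - 1)"
  have "\<exists>k. [p ^ k = 1 + l ^ c * t] (mod l ^ i)" if "c \<le> i" "t < l ^ (i - c)" for i t
  proof -
    have "1 + l ^ c * t \<in> (\<lambda>k. ?q ^ k mod l ^ i) ` {..<l ^ (i - c)}"
      unfolding powers_eq_principal_units[OF l q \<open>?q > 1\<close> c_def that(1)] using that(2) by blast
    then obtain k where "1 + l ^ c * t = ?q ^ k mod l ^ i" by blast
    hence "[p ^ (totient (l ^ 2) * k) = 1 + l ^ c * t] (mod l ^ i)"
      by (simp add: cong_def power_mult)
    thus ?thesis by blast
  qed
  with that show thesis by blast
qed

section \<open>Valuations\<close>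

locale valued_field =
  fixes v :: "'a::field \<Rightarrow> ereal"
  assumes val: "valuation v"
begin

lemma v_eq_infinity_iff: "v x = \<infinity> \<longleftrightarrow> x = 0"
  and v_neq_minus_infinity: "v x \<noteq> - \<infinity>"
  and v_mult: "v (x * y) = v x + v y"
  and v_add: "min (v x) (v y) \<le> v (x + y)"
  using val by (auto simp: valuation_def)

lemma v_0: "v 0 = \<infinity>" by (simp add: v_eq_infinity_iff)

lemma v_finite: "x \<noteq> 0 \<Longrightarrow> \<exists>r. v x = ereal r"
  using v_eq_infinity_iff[of x] v_neq_minus_infinity[of x] by (cases "v x") auto

lemma v_1: "v 1 = 0"
proof -
  obtain r where "v 1 = ereal r" using v_finite[of 1] by auto
  thus ?thesis using v_mult[of 1 1] by (simp add: zero_ereal_def)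
qed

lemma v_power: "v (x ^ n) = ereal (real n) * v x"
proof (cases "x = 0")
  case True
  thus ?thesis by (cases n) (auto simp: v_1 v_0)
next
  case False
  then obtain r where r: "v x = ereal r" using v_finite by blast
  show ?thesis
    by (induction n) (auto simp: v_1 v_mult r algebra_simps zero_ereal_def)
qed

lemma v_root_of_unity: "x ^ N = 1 \<Longrightarrow> N > 0 \<Longrightarrow> v x = 0"
  using v_power[of x N] v_1 by (cases "v x") (auto simp: zero_ereal_def)

lemma v_minus: "v (- x) = v x"
proof -
  have "v (- 1) = 0" by (rule v_root_of_unity[of _ 2]) auto
  thus ?thesis using v_mult[of "- 1" x] by simp
qed

lemma v_prod: "v (\<Prod>a\<in>A. y a) = (\<Sum>a\<in>A. v (y a))"
  by (induction A rule: infinite_finite_induct) (auto simp: v_1 v_mult)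

lemma v_nonneg_add: "0 \<le> v x \<Longrightarrow> 0 \<le> v y \<Longrightarrow> 0 \<le> v (x + y)"
  using v_add[of x y] by (auto simp: min_def split: if_splits intro: order_trans)

lemma v_pos_add: "0 < v x \<Longrightarrow> 0 < v y \<Longrightarrow> 0 < v (x + y)"
  using v_add[of x y] by (auto simp: min_def split: if_splits intro: less_le_trans)

lemma v_pos_diff: "0 < v x \<Longrightarrow> 0 < v y \<Longrightarrow> 0 < v (x - y)"
  using v_pos_add[of x "- y"] by (simp add: v_minus)

lemma v_nonneg_mult: "0 \<le> v x \<Longrightarrow> 0 \<le> v y \<Longrightarrow> 0 \<le> v (x * y)"
  by (simp add: v_mult)

lemma v_pos_mult: "0 < v x \<Longrightarrow> 0 \<le> v y \<Longrightarrow> 0 < v (x * y)"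
  by (simp add: v_mult add_pos_nonneg)

lemma v_nonneg_sum: "(\<And>a. a \<in> A \<Longrightarrow> 0 \<le> v (y a)) \<Longrightarrow> 0 \<le> v (\<Sum>a\<in>A. y a)"
  by (induction A rule: infinite_finite_induct) (auto simp: v_0 v_nonneg_add)

lemma v_pos_sum: "(\<And>a. a \<in> A \<Longrightarrow> 0 < v (y a)) \<Longrightarrow> 0 < v (\<Sum>a\<in>A. y a)"
  by (induction A rule: infinite_finite_induct) (auto simp: v_0 v_pos_add)

lemma v_nonneg_power: "0 \<le> v x \<Longrightarrow> 0 \<le> v (x ^ n)"
  by (simp add: v_power)

lemma v_pos_power: "0 < v x \<Longrightarrow> n > 0 \<Longrightarrow> 0 < v (x ^ n)"
  by (simp add: v_power ereal_zero_less_0_iff)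

lemma v_nonneg_of_nat: "0 \<le> v (of_nat n)"
  by (induction n) (auto simp: v_0 v_1 v_nonneg_add)

lemma v_nonneg_of_int: "0 \<le> v (of_int n)"
  by (cases n) (auto simp: v_minus v_nonneg_of_nat simp del: of_nat_Suc)

lemma v_padic_power:
  fixes a :: "'l::prime_card padic_int"
  assumes "\<xi> ^ (CARD('l) ^ m) = 1"
  shows "v (padic_power \<xi> a) = 0"
  using padic_power_root_of_unity[OF assms] by (rule v_root_of_unity) simp

lemma v_nonneg_gp_eval:
  fixes P :: "('l::prime_card, int) gen_poly"
  assumes "\<xi> ^ (CARD('l) ^ m) = 1"
  shows "0 \<le> v (gp_eval P \<xi>)"
  unfolding gp_eval_def
  by (intro v_nonneg_sum v_nonneg_mult v_nonneg_of_int) (simp add: v_padic_power[OF assms])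

end

lemma fermat_little_int:
  fixes k :: int
  assumes p: "prime p"
  shows "[k ^ p = k] (mod int p)"
proof -
  have "p > 0" using p prime_gt_0_nat by blast
  define m where "m = nat (k mod int p)"
  have m: "[k = int m] (mod int p)" using \<open>p > 0\<close> by (simp add: m_def cong_def)
  have "[m ^ p = m] (mod p)"
  proof (cases "p dvd m")
    case True
    moreover have "p dvd m ^ p" using True \<open>p > 0\<close> by (meson dvd_power dvd_trans)
    ultimately show ?thesis by (simp add: cong_def)
  next
    case False
    hence "[m ^ (p - 1) * m = 1 * m] (mod p)"
      using fermat_theorem[OF p] by (intro cong_scalar_right)
    thus ?thesis using power_minus_mult[OF \<open>p > 0\<close>, of m] by simp
  qed
  hence "[int m ^ p = int m] (mod int p)" by (metis cong_int_iff of_nat_power)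
  thus ?thesis using m cong_pow[OF m, of p] by (metis cong_sym cong_trans)
qed

locale padic_valued_field = valued_field v for v :: "'a::field \<Rightarrow> ereal" +
  fixes p :: nat
  assumes prime_p: "prime p" and v_of_p: "v (of_nat p) = 1"
begin

lemma v_pos_of_int_iff: "0 < v (of_int k) \<longleftrightarrow> int p dvd k"
proof
  assume "int p dvd k"
  then obtain m where "k = int p * m" by (auto simp: dvd_def)
  thus "0 < v (of_int k)" using v_pos_mult[of "of_nat p" "of_int m"] v_of_p v_nonneg_of_int by simp
next
  assume k: "0 < v (of_int k)"
  show "int p dvd k"
  proof (rule ccontr)
    assume "\<not> int p dvd k"
    hence "coprime (int p) k" using prime_p by (simp add: prime_imp_coprime)
    then obtain a b where "a * int p + b * k = 1" by (metis bezout_int coprime_imp_gcd_eq_1)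
    hence "(1 :: 'a) = of_nat p * of_int a + of_int k * of_int b"
      by (metis mult.commute of_int_1 of_int_add of_int_mult of_int_of_nat_eq)
    moreover have "0 < v (of_nat p * of_int a + of_int k * of_int b)"
      using k v_of_p by (intro v_pos_add v_pos_mult v_nonneg_of_int) auto
    ultimately show False by (simp add: v_1)
  qed
qed

lemma v_of_nat:
  assumes "k \<noteq> 0"
  shows "v (of_nat k) = ereal (real (multiplicity p k))"
proof -
  obtain m where m: "k = p ^ multiplicity p k * m" "\<not> p dvd m"
    using multiplicity_decompose'[OF assms, of p] prime_p not_prime_unit by metis
  have "\<not> 0 < v (of_nat m)" using v_pos_of_int_iff[of "int m"] m(2) by simp
  hence "v (of_nat m) = 0" using v_nonneg_of_nat[of m] by (metis less_le)
  moreover have "v (of_nat k) = v (of_nat p ^ multiplicity p k * of_nat m)"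
    by (subst m(1)) simp
  ultimately show ?thesis by (simp add: v_mult v_power v_of_p)
qed

lemma of_nat_neq_0: "k \<noteq> 0 \<Longrightarrow> of_nat k \<noteq> (0 :: 'a)"
  using v_of_nat[of k] v_0 by (metis PInfty_neq_ereal(1))

lemma frobenius_add:
  assumes "0 \<le> v x" "0 \<le> v y"
  shows "0 < v ((x + y) ^ p - (x ^ p + y ^ p))"
proof -
  have "p > 0" using prime_p prime_gt_0_nat by blast
  hence "{..p} = insert 0 (insert p {1..<p})" by auto
  hence "(x + y) ^ p - (x ^ p + y ^ p) = (\<Sum>k\<in>{1..<p}. of_nat (p choose k) * x ^ k * y ^ (p - k))"
    using \<open>p > 0\<close> by (simp add: binomial_ring)
  also have "0 < v \<dots>"
  proof (rule v_pos_sum)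
    fix k assume "k \<in> {1..<p}"
    hence "p dvd p choose k" using prime_p by (intro dvd_choose_prime) auto
    hence "0 < v (of_nat (p choose k))" using v_pos_of_int_iff[of "int (p choose k)"] by simp
    thus "0 < v (of_nat (p choose k) * x ^ k * y ^ (p - k))"
      using assms by (intro v_pos_mult v_nonneg_power)
  qed
  finally show ?thesis .
qed

lemma frobenius_sum:
  assumes "\<And>a. a \<in> A \<Longrightarrow> 0 \<le> v (y a)"
  shows "0 < v ((\<Sum>a\<in>A. y a) ^ p - (\<Sum>a\<in>A. y a ^ p))"
  using assms
proof (induction A rule: infinite_finite_induct)
  case (insert b A)
  let ?s = "\<Sum>a\<in>A. y a"
  have "0 < v ((y b + ?s) ^ p - (y b ^ p + ?s ^ p))"
    using insert.prems by (intro frobenius_add v_nonneg_sum) auto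
  moreover have "0 < v (?s ^ p - (\<Sum>a\<in>A. y a ^ p))" using insert by simp
  ultimately have "0 < v (((y b + ?s) ^ p - (y b ^ p + ?s ^ p)) + (?s ^ p - (\<Sum>a\<in>A. y a ^ p)))"
    by (rule v_pos_add)
  thus ?case using insert.hyps by (simp add: algebra_simps)
qed (use prime_p prime_gt_0_nat in \<open>auto simp: v_0 power_0_left\<close>)

lemma gp_eval_frobenius:
  fixes P :: "('l::prime_card, int) gen_poly"
  assumes \<xi>: "\<xi> ^ (CARD('l) ^ m) = 1"
  shows "0 < v (gp_eval P \<xi> ^ p - gp_eval P (\<xi> ^ p))"
proof -
  let ?K = "Poly_Mapping.keys P" and ?c = "Poly_Mapping.lookup P"
  have "0 < v (gp_eval P \<xi> ^ p - (\<Sum>a\<in>?K. (of_int (?c a) * padic_power \<xi> a) ^ p))"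
    unfolding gp_eval_def
    by (intro frobenius_sum v_nonneg_mult v_nonneg_of_int) (simp add: v_padic_power[OF \<xi>])
  moreover have "0 < v (\<Sum>a\<in>?K. of_int (?c a ^ p - ?c a) * padic_power \<xi> a ^ p)"
    using fermat_little_int[OF prime_p]
    by (intro v_pos_sum v_pos_mult v_nonneg_power)
       (simp_all only: v_pos_of_int_iff cong_iff_dvd_diff v_padic_power[OF \<xi>] order_refl)
  ultimately have "0 < v (gp_eval P \<xi> ^ p - (\<Sum>a\<in>?K. (of_int (?c a) * padic_power \<xi> a) ^ p)
      + (\<Sum>a\<in>?K. of_int (?c a ^ p - ?c a) * padic_power \<xi> a ^ p))"
    by (rule v_pos_add)
  thus ?thesis
    by (simp add: gp_eval_def padic_power_power[OF \<xi>] power_mult_distrib sum_subtractf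
        algebra_simps)
qed

lemma gp_eval_frobenius_orbit:
  fixes P :: "('l::prime_card, int) gen_poly"
  assumes \<xi>: "\<xi> ^ (CARD('l) ^ m) = 1" and pos: "0 < v (gp_eval P \<xi>)"
  shows "0 < v (gp_eval P (\<xi> ^ (p ^ k)))"
proof (induction k)
  case 0
  show ?case using pos by simp
next
  case (Suc k)
  let ?\<eta> = "\<xi> ^ (p ^ k)"
  have "0 < v (gp_eval P ?\<eta> ^ p - (gp_eval P ?\<eta> ^ p - gp_eval P (?\<eta> ^ p)))"
    using Suc.IH prime_p prime_gt_0_nat
    by (intro v_pos_diff v_pos_power gp_eval_frobenius[of _ m] power_of_root_of_unity \<xi>) auto
  thus ?case by (simp add: mult.commute flip: power_mult)
qed

end

section \<open>Eventual nonvanishing in the residue field\<close>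

lemma padic_red_diff_eq_0_iff:
  "padic_red m (a - b) = 0 \<longleftrightarrow> padic_red m a = padic_red m (b :: 'l::prime_card padic_int)"
proof -
  have "padic_red m (a - b) = 0 \<longleftrightarrow> int CARD('l) ^ m dvd padic_red m a - padic_red m b"
    by (simp add: padic_red_diff mod_eq_0_iff_dvd)
  also have "\<dots> \<longleftrightarrow> padic_red m a mod int CARD('l) ^ m = padic_red m b mod int CARD('l) ^ m"
    by (rule mod_eq_dvd_iff[symmetric])
  finally show ?thesis by simp
qed

lemma eventually_inj_on_padic_red:
  fixes A :: "'l::prime_card padic_int set"
  assumes "finite A"
  shows "eventually (\<lambda>m. inj_on (padic_red m) A) sequentially"
proof -
  have "eventually (\<lambda>m. padic_red m a = padic_red m b \<longrightarrow> a = b) sequentially"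
    for a b :: "'l padic_int"
  proof (cases "a = b")
    case False
    then obtain r where r: "padic_red r a \<noteq> padic_red r b" using padic_eqI by blast
    have "padic_red m a \<noteq> padic_red m b" if "m \<ge> r" for m
      using r padic_red_mod[OF that, of a] padic_red_mod[OF that, of b] by metis
    thus ?thesis unfolding eventually_sequentially by blast
  qed simp
  thus ?thesis
    unfolding inj_on_def using assms by (intro eventually_ball_finite ballI)
qed

lemma padic_power_power_eq_1_iff:
  fixes a :: "'l::prime_card padic_int"
  assumes \<xi>: "primitive_root_of_unity (CARD('l) ^ i) \<xi>" and "c \<le> i"
  shows "padic_power \<xi> a ^ (CARD('l) ^ c) = 1 \<longleftrightarrow> padic_red (i - c) a = 0"
proof -
  let ?l = "CARD('l)" and ?d = "nat (padic_red i a)"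
  have split: "?l ^ i = ?l ^ (i - c) * ?l ^ c" using \<open>c \<le> i\<close> by (simp flip: power_add)
  have "padic_power \<xi> a = \<xi> ^ ?d"
    by (intro padic_power_eq primitive_root_power_self \<xi>)
  hence "padic_power \<xi> a ^ (?l ^ c) = 1 \<longleftrightarrow> ?l ^ i dvd ?d * ?l ^ c"
    using primitive_root_power_eq_1_iff[OF \<xi>, of "?d * ?l ^ c"] by (simp add: power_mult)
  also have "\<dots> \<longleftrightarrow> ?l ^ (i - c) dvd ?d" unfolding split by simp
  also have "\<dots> \<longleftrightarrow> int ?l ^ (i - c) dvd padic_red i a"
    using padic_red_range(1)[of i a] by (metis int_dvd_int_iff int_nat_eq of_nat_power)
  also have "\<dots> \<longleftrightarrow> padic_red (i - c) a = 0"
    using padic_red_mod[of "i - c" i a] by (simp add: dvd_eq_mod_eq_0)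
  finally show ?thesis .
qed

lemma sum_padic_power_principal_units:
  fixes a :: "'l::prime_card padic_int" and \<xi> :: "'a::field"
  assumes \<xi>: "primitive_root_of_unity (CARD('l) ^ i) \<xi>" and "c \<le> i"
  shows "(\<Sum>t<CARD('l) ^ (i - c). padic_power \<xi> a ^ (1 + CARD('l) ^ c * t))
    = (if padic_red (i - c) a = 0 then of_nat (CARD('l) ^ (i - c)) * padic_power \<xi> a else 0)"
proof -
  let ?l = "CARD('l)" and ?\<omega> = "padic_power \<xi> a"
  have "\<xi> ^ (?l ^ i) = 1" using \<xi> by (rule primitive_root_power_self)
  hence "?\<omega> ^ (?l ^ i) = 1" by (rule padic_power_root_of_unity)
  hence "(?\<omega> ^ (?l ^ c)) ^ (?l ^ (i - c)) = 1"
    using \<open>c \<le> i\<close> by (simp flip: power_mult power_add)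
  moreover have "(\<Sum>t<?l ^ (i - c). ?\<omega> ^ (1 + ?l ^ c * t))
      = ?\<omega> * (\<Sum>t<?l ^ (i - c). (?\<omega> ^ (?l ^ c)) ^ t)"
    by (simp add: power_mult sum_distrib_left)
  ultimately show ?thesis
    by (simp add: sum_powers_root_of_unity padic_power_power_eq_1_iff[OF \<xi> \<open>c \<le> i\<close>])
qed

text \<open>
  Averaging over the conjugates \<open>\<xi>^(1 + l^c t)\<close> isolates the coefficient of \<open>T^b\<close>, as soon as the
  exponents of \<open>P\<close> are distinct modulo \<open>l^(i - c)\<close>.
\<close>

lemma sum_gp_eval_conjugates:
  fixes P :: "('l::prime_card, int) gen_poly" and \<xi> :: "'a::field"
  assumes \<xi>: "primitive_root_of_unity (CARD('l) ^ i) \<xi>" and "c \<le> i"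
    and inj: "inj_on (padic_red (i - c)) (Poly_Mapping.keys P)" and b: "b \<in> Poly_Mapping.keys P"
  defines "u \<equiv> \<lambda>t. 1 + CARD('l) ^ c * t"
  shows "(\<Sum>t<CARD('l) ^ (i - c). gp_eval P (\<xi> ^ u t) * padic_power (\<xi> ^ u t) (- b))
    = of_int (Poly_Mapping.lookup P b * int (CARD('l) ^ (i - c)))"
proof -
  let ?K = "Poly_Mapping.keys P" and ?c = "Poly_Mapping.lookup P" and ?M = "CARD('l) ^ (i - c)"
  have root: "\<xi> ^ (CARD('l) ^ i) = 1" using \<xi> by (rule primitive_root_power_self)
  have shift: "padic_power \<xi> a * padic_power \<xi> (- b) = padic_power \<xi> (a - b)" for a
    using padic_power_add[OF root, of a "- b"] by simp
  have conjugate: "gp_eval P (\<xi> ^ u t) * padic_power (\<xi> ^ u t) (- b)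
      = (\<Sum>a\<in>?K. of_int (?c a) * padic_power \<xi> (a - b) ^ u t)" for t
    by (simp add: gp_eval_def padic_power_power[OF root] sum_distrib_right mult.assoc
        flip: power_mult_distrib shift)
  have orthogonality: "(\<Sum>t<?M. padic_power \<xi> (a - b) ^ u t) = (if a = b then of_nat ?M else 0)"
    if a: "a \<in> ?K" for a
  proof -
    have "padic_red (i - c) (a - b) = 0 \<longleftrightarrow> a = b"
      unfolding padic_red_diff_eq_0_iff using inj a b by (auto dest: inj_onD)
    moreover have "padic_power \<xi> (0 :: 'l padic_int) = 1"
      by (simp add: padic_power_eq[OF root] padic_red_0)
    ultimately show ?thesis
      unfolding u_def sum_padic_power_principal_units[OF \<xi> \<open>c \<le> i\<close>] by auto
  qed
  have "(\<Sum>t<?M. gp_eval P (\<xi> ^ u t) * padic_power (\<xi> ^ u t) (- b))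
      = (\<Sum>a\<in>?K. of_int (?c a) * (\<Sum>t<?M. padic_power \<xi> (a - b) ^ u t))"
    unfolding conjugate sum_distrib_left by (rule sum.swap)
  also have "\<dots> = (\<Sum>a\<in>?K. if a = b then of_int (?c b) * of_nat ?M else 0)"
    by (intro sum.cong refl) (simp add: orthogonality)
  also have "\<dots> = of_int (?c b * int ?M)" using b by simp
  finally show ?thesis .
qed

theorem (in padic_valued_field) gp_eval_eventually_unit:
  fixes P :: "('l::prime_card, int) gen_poly"
  assumes "CARD('l) \<noteq> p" and b: "\<not> int p dvd Poly_Mapping.lookup P b"
  shows "eventually (\<lambda>i. \<forall>\<xi>. primitive_root_of_unity (CARD('l) ^ i) \<xi> \<longrightarrow> \<not> 0 < v (gp_eval P \<xi>))
    sequentially"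
proof -
  let ?l = "CARD('l)"
  have l: "prime ?l" by (rule prime_card)
  have b_in_keys: "b \<in> Poly_Mapping.keys P" using b by (auto simp: in_keys_iff)
  have "coprime p ?l" using prime_p l \<open>?l \<noteq> p\<close> by (metis primes_coprime)
  then obtain c
    where powers: "\<And>i t. c \<le> i \<Longrightarrow> t < ?l ^ (i - c) \<Longrightarrow> \<exists>k. [p ^ k = 1 + ?l ^ c * t] (mod ?l ^ i)"
    using principal_units_are_powers[OF l prime_gt_1_nat[OF prime_p]] by blast
  obtain r where separates: "\<And>m. m \<ge> r \<Longrightarrow> inj_on (padic_red m) (Poly_Mapping.keys P)"
    using eventually_inj_on_padic_red[of "Poly_Mapping.keys P"]
    by (auto simp: eventually_sequentially)
  have "\<not> 0 < v (gp_eval P \<xi>)"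
    if i: "c + r \<le> i" and \<xi>: "primitive_root_of_unity (?l ^ i) \<xi>" for i \<xi>
  proof
    assume pos: "0 < v (gp_eval P \<xi>)"
    have "c \<le> i" "r \<le> i - c" using i by auto
    have root: "\<xi> ^ (?l ^ i) = 1" using \<xi> by (rule primitive_root_power_self)
    define u where "u t = 1 + ?l ^ c * t" for t
    have "0 < v (gp_eval P (\<xi> ^ u t))" if t: "t < ?l ^ (i - c)" for t
    proof -
      obtain k where "[p ^ k = u t] (mod ?l ^ i)" unfolding u_def using powers \<open>c \<le> i\<close> t by blast
      hence "\<xi> ^ (p ^ k) = \<xi> ^ u t" by (metis cong_def power_mod_exponent[OF root])
      thus ?thesis using gp_eval_frobenius_orbit[OF root pos, of k] by simp
    qed
    hence "0 < v (\<Sum>t<?l ^ (i - c). gp_eval P (\<xi> ^ u t) * padic_power (\<xi> ^ u t) (- b))"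
      by (intro v_pos_sum v_pos_mult) (auto simp: v_padic_power[OF power_of_root_of_unity[OF root]])
    hence "int p dvd Poly_Mapping.lookup P b * int (?l ^ (i - c))"
      unfolding u_def sum_gp_eval_conjugates[OF \<xi> \<open>c \<le> i\<close> separates[OF \<open>r \<le> i - c\<close>] b_in_keys]
        v_pos_of_int_iff .
    hence "int p dvd int (?l ^ (i - c))" using b prime_p by (simp add: prime_dvd_mult_iff)
    hence "p dvd ?l" using prime_p by (metis int_dvd_int_iff prime_dvd_power)
    thus False using prime_p l \<open>?l \<noteq> p\<close> by (metis primes_dvd_imp_eq)
  qed
  thus ?thesis unfolding eventually_sequentially by blast
qed

section \<open>The \<open>\<mu>\<close>-invariant\<close>

lemma enat_le_int_ord_iff:
  assumes "prime p"
  shows "enat n \<le> int_ord p c \<longleftrightarrow> int p ^ n dvd c"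
  using assms power_dvd_iff_le_multiplicity[of c "int p" n] prime_gt_1_nat[OF assms]
  by (auto simp: int_ord_def)

lemma enat_le_gp_mu_iff:
  assumes "prime p"
  shows "enat n \<le> gp_mu p P \<longleftrightarrow> (\<forall>a. int p ^ n dvd Poly_Mapping.lookup P a)"
  unfolding gp_mu_def by (simp add: le_INF_iff enat_le_int_ord_iff[OF assms])

lemma gp_mu_eq_0_iff:
  assumes "prime p"
  shows "gp_mu p P = 0 \<longleftrightarrow> (\<exists>b. \<not> int p dvd Poly_Mapping.lookup P b)"
proof -
  have "gp_mu p P = 0 \<longleftrightarrow> \<not> enat 1 \<le> gp_mu p P"
    by (cases "gp_mu p P") (auto simp: zero_enat_def)
  thus ?thesis by (simp add: enat_le_gp_mu_iff[OF assms])
qed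

lemma gp_mu_neq_infinity:
  assumes "P \<noteq> 0"
  shows "gp_mu p P \<noteq> \<infinity>"
proof -
  obtain a where "Poly_Mapping.lookup P a \<noteq> 0" using assms by (metis lookup_zero poly_mapping_eqI)
  hence "int_ord p (Poly_Mapping.lookup P a) \<noteq> \<infinity>" by (simp add: int_ord_def)
  moreover have "gp_mu p P \<le> int_ord p (Poly_Mapping.lookup P a)"
    unfolding gp_mu_def by (rule INF_lower) simp
  ultimately show ?thesis by (auto dest: enat_ile)
qed

lemma lookup_of_nat_mult:
  fixes P :: "('l::prime_card, int) gen_poly"
  shows "Poly_Mapping.lookup (of_nat k * P) a = int k * Poly_Mapping.lookup P a"
  by (induction k) (simp_all add: distrib_right lookup_add)

lemma gp_mu_decomposition:
  fixes P :: "('l::prime_card, int) gen_poly"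
  assumes p: "prime p" and P: "P \<noteq> 0"
  obtains \<mu> g where "gp_mu p P = enat \<mu>" "P = of_nat (p ^ \<mu>) * g" "gp_mu p g = 0"
proof -
  obtain \<mu> where \<mu>: "gp_mu p P = enat \<mu>" using gp_mu_neq_infinity[OF P] by auto
  define g where "g = Poly_Mapping.map (\<lambda>c. c div int p ^ \<mu>) P"
  have "int p ^ \<mu> dvd Poly_Mapping.lookup P a" for a using \<mu> enat_le_gp_mu_iff[OF p, of \<mu> P] by simp
  hence lookup: "Poly_Mapping.lookup P a = int p ^ \<mu> * Poly_Mapping.lookup g a" for a
    by (simp add: g_def Poly_Mapping.map.rep_eq when_def)
  have "gp_mu p g = 0"
  proof (rule ccontr)
    assume "gp_mu p g \<noteq> 0"
    hence "int p ^ Suc \<mu> dvd Poly_Mapping.lookup P a" for a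
      unfolding lookup using gp_mu_eq_0_iff[OF p, of g] by (simp add: mult.commute mult_dvd_mono)
    hence "enat (Suc \<mu>) \<le> gp_mu p P" by (simp add: enat_le_gp_mu_iff[OF p])
    thus False by (simp add: \<mu>)
  qed
  moreover have "P = of_nat (p ^ \<mu>) * g"
    by (rule poly_mapping_eqI, unfold lookup_of_nat_mult lookup) simp
  ultimately show thesis using that \<mu> by blast
qed

lemma (in padic_valued_field) ex_gp_eval_notin_maximal_ideal_from:
  fixes g :: "('l::prime_card, int) gen_poly"
  assumes "CARD('l) \<noteq> p" and "gp_mu p g = 0"
  shows "\<exists>n>0. \<forall>i\<ge>n. \<forall>\<xi>\<in>K.
    primitive_root_of_unity (CARD('l) ^ i) \<xi> \<longrightarrow> gp_eval g \<xi> \<notin> maximal_ideal_on v K"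
proof -
  obtain b where "\<not> int p dvd Poly_Mapping.lookup g b"
    using assms(2) gp_mu_eq_0_iff[OF prime_p] by blast
  then obtain n where
    "\<And>i \<xi>. n \<le> i \<Longrightarrow> primitive_root_of_unity (CARD('l) ^ i) \<xi> \<Longrightarrow> \<not> 0 < v (gp_eval g \<xi>)"
    using gp_eval_eventually_unit[OF assms(1)] unfolding eventually_sequentially by blast
  thus ?thesis unfolding maximal_ideal_on_def by (intro exI[of _ "Suc n"]) (auto dest: Suc_leD)
qed

section \<open>The cyclotomic extension of the p-adic numbers\<close>

lemma padic_int_ord_1: "padic_int_ord (1 :: 'p::prime_card padic_int) = 0"
  using padic_int_ord_mult[of 1 "1 :: 'p padic_int"] by simp

lemma padic_of_nat_card_neq_0: "(of_nat CARD('p) :: 'p::prime_card padic_int) \<noteq> 0"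
  and padic_int_ord_of_nat_card: "padic_int_ord (of_nat CARD('p) :: 'p padic_int) = 1"
proof -
  let ?q = "of_nat CARD('p) :: 'p padic_int"
  have p: "CARD('p) > 1" using prime_card[where 'a = 'p] prime_gt_1_nat by blast
  hence "int CARD('p) < int CARD('p) ^ 2" by (simp add: power2_eq_square)
  hence red: "padic_red 2 ?q \<noteq> 0" using p by (simp add: padic_red_of_nat)
  thus nonzero: "?q \<noteq> 0" by (metis padic_red_0)
  have "1 \<le> padic_int_ord ?q" using padic_power_dvd_iff_le_ord[OF nonzero, of 1] by simp
  moreover have "\<not> 2 \<le> padic_int_ord ?q"
    using padic_power_dvd_iff_le_ord[OF nonzero, of 2] padic_power_dvd_iff[of 2 ?q] red by simp
  ultimately show "padic_int_ord ?q = 1" by simp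
qed

lemma extends_padic_ord_card:
  fixes v :: "'p::prime_card padic_ac \<Rightarrow> ereal"
  assumes "extends_padic_ord v"
  shows "v (of_nat CARD('p)) = 1"
proof -
  have "v (of_nat CARD('p)) = padic_ord (of_nat CARD('p) :: 'p padic)"
    using assms unfolding extends_padic_ord_def by (metis to_ac_of_nat)
  also have "(of_nat CARD('p) :: 'p padic) = Fract (of_nat CARD('p)) 1" by (rule of_nat_fract)
  also have "padic_ord \<dots> = 1"
    by (subst padic_ord_Fract)
       (simp_all add: padic_of_nat_card_neq_0 padic_int_ord_of_nat_card padic_int_ord_1
         one_ereal_def)
  finally show ?thesis .
qed

lemma of_int_in_padic_adjoin: "of_int k \<in> padic_adjoin \<xi>"
proof -
  have "of_int k \<in> range to_ac \<union> {\<xi>}" by (metis UnI1 rangeI to_ac_of_int)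
  thus ?thesis unfolding padic_adjoin_def by (rule generate_field.incl)
qed

lemma generator_in_padic_adjoin: "\<xi> \<in> padic_adjoin \<xi>"
  unfolding padic_adjoin_def by (rule generate_field.incl) simp

lemma padic_adjoin_add: "x \<in> padic_adjoin \<xi> \<Longrightarrow> y \<in> padic_adjoin \<xi> \<Longrightarrow> x + y \<in> padic_adjoin \<xi>"
  unfolding padic_adjoin_def
  by (drule (1) generate_field.eng_add) (simp add: ring_of_type_algebra_def)

lemma padic_adjoin_mult: "x \<in> padic_adjoin \<xi> \<Longrightarrow> y \<in> padic_adjoin \<xi> \<Longrightarrow> x * y \<in> padic_adjoin \<xi>"
  unfolding padic_adjoin_def
  by (drule (1) generate_field.eng_mult) (simp add: ring_of_type_algebra_def)

lemma padic_adjoin_power: "x \<in> padic_adjoin \<xi> \<Longrightarrow> x ^ n \<in> padic_adjoin \<xi>"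
  using of_int_in_padic_adjoin[of 1 \<xi>] by (induction n) (auto intro: padic_adjoin_mult)

lemma gp_eval_in_padic_adjoin:
  assumes "x \<in> padic_adjoin \<xi>"
  shows "gp_eval P x \<in> padic_adjoin \<xi>"
proof -
  have "(\<Sum>a\<in>A. of_int (c a) * padic_power x (e a)) \<in> padic_adjoin \<xi>" for A c e
    using of_int_in_padic_adjoin[of 0 \<xi>] assms
    by (induction A rule: infinite_finite_induct)
       (auto simp: padic_power_def
         intro!: of_int_in_padic_adjoin padic_adjoin_add padic_adjoin_mult padic_adjoin_power)
  thus ?thesis unfolding gp_eval_def .
qed

lemma gp_eval_root_power_not_pos:
  fixes \<zeta> :: "nat \<Rightarrow> 'p::prime_card padic_ac"
  defines "K \<equiv> padic_cyclotomic_union \<zeta>"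
  assumes "primitive_root_of_unity N (\<zeta> i)" "N > 0" "coprime t N"
    and "\<forall>\<xi>\<in>K. primitive_root_of_unity N \<xi> \<longrightarrow> gp_eval P \<xi> \<notin> maximal_ideal_on v K"
  shows "\<not> 0 < v (gp_eval P (\<zeta> i ^ t))"
proof -
  have "\<zeta> i ^ t \<in> padic_adjoin (\<zeta> i)" by (intro padic_adjoin_power generator_in_padic_adjoin)
  moreover hence "gp_eval P (\<zeta> i ^ t) \<in> padic_adjoin (\<zeta> i)" by (rule gp_eval_in_padic_adjoin)
  ultimately have "\<zeta> i ^ t \<in> K" "gp_eval P (\<zeta> i ^ t) \<in> K"
    unfolding K_def padic_cyclotomic_union_def by blast+
  moreover have "primitive_root_of_unity N (\<zeta> i ^ t)"
    using assms(2,4,3) by (rule primitive_root_coprime_power)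
  ultimately show ?thesis using assms(5) by (auto simp: maximal_ideal_on_def)
qed

section \<open>Growth of the number of spanning trees\<close>

locale connected_tower =
  oriented_multigraph G S + padic_valued_field v p
  for G :: "('v, 'e) multigraph" and S :: "'e set" and v :: "'a::field \<Rightarrow> ereal" and p :: nat +
  fixes vs :: "'v list" and \<alpha> :: "'e \<Rightarrow> 'l::prime_card padic_int"
  assumes vs: "distinct vs" "set vs = verts G"
    and connected_layers: "n \<ge> 1 \<Longrightarrow> connected_multigraph (tower_layer G S \<alpha> n)"
    and distinct_primes: "CARD('l) \<noteq> p"
begin

definition \<kappa> :: "nat \<Rightarrow> nat" where
  "\<kappa> n = card (spanning_trees (tower_layer G S \<alpha> n))"

definition f :: "('l, int) gen_poly" where
  "f = det (voltage_matrix G vs S \<alpha>)"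

lemma \<kappa>_neq_0:
  assumes "n \<ge> 1"
  shows "\<kappa> n \<noteq> 0"
proof -
  interpret layer: fin_multigraph "tower_layer G S \<alpha> n"
    unfolding tower_layer_def
    by (intro fin_multigraph.intro finite_multigraph_derived finite_G S_subset) simp
  show ?thesis
    using layer.card_spanning_trees_pos[OF connected_layers[OF assms]] by (simp add: \<kappa>_def)
qed

lemma v_\<kappa>: "n \<ge> 1 \<Longrightarrow> v (of_nat (\<kappa> n)) = ereal (real (multiplicity p (\<kappa> n)))"
  by (intro v_of_nat \<kappa>_neq_0)

lemma v_\<kappa>_Suc:
  assumes "primitive_root_of_unity (CARD('l) ^ Suc n) \<zeta>"
  shows "v (of_nat (\<kappa> (Suc n)))
    = v (of_nat (\<kappa> n)) + (\<Sum>t\<in>totatives (CARD('l) ^ Suc n). v (gp_eval f (\<zeta> ^ t)))"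
proof -
  have "verts G \<noteq> {}"
    using connected_layers[of 1]
    by (auto simp: connected_multigraph_def tower_layer_def derived_multigraph_def)
  hence "of_nat (length vs * CARD('l)) \<noteq> (0 :: 'a)" using vs by (intro of_nat_neq_0) auto
  hence "v (of_nat (CARD('l) * \<kappa> (Suc n)))
      = v (of_nat (\<kappa> n) * (\<Prod>t\<in>totatives (CARD('l) ^ Suc n). gp_eval f (\<zeta> ^ t)))"
    unfolding \<kappa>_def f_def using card_spanning_trees_tower_Suc[OF vs _ assms, of \<alpha>] by simp
  moreover have "v (of_nat CARD('l)) = 0"
  proof -
    have "\<not> p dvd CARD('l)" using prime_p prime_card[where 'a = 'l] distinct_primes
      by (metis primes_dvd_imp_eq)
    thus ?thesis
      using v_of_nat[of "CARD('l)"] by (simp add: not_dvd_imp_multiplicity_0 zero_ereal_def)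
  qed
  ultimately show ?thesis by (simp add: v_mult v_prod)
qed

lemma f_neq_0:
  assumes "primitive_root_of_unity CARD('l) (\<zeta> :: 'a)"
  shows "f \<noteq> 0"
proof
  assume "f = 0"
  have "(\<Sum>t\<in>totatives CARD('l). v (gp_eval f (\<zeta> ^ t))) = \<infinity>"
    unfolding \<open>f = 0\<close> gp_eval_0 v_0 sum_Pinfty by (intro conjI bexI[of _ 1]) simp_all
  hence "v (of_nat (\<kappa> 1)) = \<infinity>" using v_\<kappa>_Suc[of 0 \<zeta>] assms by simp
  thus False by (simp add: v_\<kappa>)
qed

lemma multiplicity_\<kappa>_Suc:
  assumes "n \<ge> 1" and \<zeta>: "primitive_root_of_unity (CARD('l) ^ Suc n) \<zeta>"
    and slope: "\<And>t. coprime t (CARD('l) ^ Suc n) \<Longrightarrow> v (gp_eval f (\<zeta> ^ t)) = ereal (real \<mu>)"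
  shows "int (multiplicity p (\<kappa> (Suc n))) - int \<mu> * int CARD('l) ^ Suc n
    = int (multiplicity p (\<kappa> n)) - int \<mu> * int CARD('l) ^ n"
proof -
  let ?l = "CARD('l)" and ?R = "totatives (CARD('l) ^ Suc n)"
  have "(\<Sum>t\<in>?R. v (gp_eval f (\<zeta> ^ t))) = (\<Sum>t\<in>?R. ereal (real \<mu>))"
    by (intro sum.cong refl slope) (simp add: in_totatives_iff)
  also have "\<dots> = ereal (real (totient (?l ^ Suc n) * \<mu>))" by (simp add: totient_def sum_ereal)
  finally have "real (multiplicity p (\<kappa> (Suc n)))
      = real (multiplicity p (\<kappa> n) + totient (?l ^ Suc n) * \<mu>)"
    using v_\<kappa>_Suc[OF \<zeta>] \<open>n \<ge> 1\<close> by (simp add: v_\<kappa>)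
  hence \<kappa>: "multiplicity p (\<kappa> (Suc n)) = multiplicity p (\<kappa> n) + totient (?l ^ Suc n) * \<mu>"
    by (simp only: of_nat_eq_iff)
  have "totient (?l ^ Suc n) = ?l ^ n * (?l - 1)" by (rule totient_prime_power_Suc[OF prime_card])
  hence totient: "int (totient (?l ^ Suc n)) = int ?l ^ Suc n - int ?l ^ n"
    by (simp add: of_nat_diff algebra_simps)
  show ?thesis unfolding \<kappa> of_nat_add of_nat_mult totient by (simp add: algebra_simps)
qed

theorem multiplicity_\<kappa>:
  assumes "n0 \<ge> 1" and \<zeta>: "\<And>i. primitive_root_of_unity (CARD('l) ^ i) (\<zeta> i)"
    and f: "f = of_nat (p ^ \<mu>) * g"
    and unit: "\<And>i t. n0 \<le> i \<Longrightarrow> coprime t (CARD('l) ^ i) \<Longrightarrow> \<not> 0 < v (gp_eval g (\<zeta> i ^ t))"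
  obtains \<nu> :: int where "\<And>n. n \<ge> n0 \<Longrightarrow>
    int (multiplicity p (\<kappa> n)) = int \<mu> * int CARD('l) ^ n + \<nu>"
proof -
  have slope: "v (gp_eval f (\<zeta> i ^ t)) = ereal (real \<mu>)"
    if "n0 \<le> i" "coprime t (CARD('l) ^ i)" for i t
  proof -
    have root: "(\<zeta> i ^ t) ^ (CARD('l) ^ i) = 1"
      by (intro power_of_root_of_unity primitive_root_power_self \<zeta>)
    have "v (gp_eval g (\<zeta> i ^ t)) = 0"
      using unit[OF that] v_nonneg_gp_eval[OF root, of g] by (metis less_le)
    thus ?thesis
      unfolding f gp_eval_of_nat_mult[OF root] by (simp add: v_mult v_power v_of_p)
  qed
  define \<nu> where "\<nu> = int (multiplicity p (\<kappa> n0)) - int \<mu> * int CARD('l) ^ n0"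
  have "int (multiplicity p (\<kappa> n)) - int \<mu> * int CARD('l) ^ n = \<nu>" if "n \<ge> n0" for n
    using that
  proof (induction n rule: dec_induct)
    case base
    show ?case by (simp add: \<nu>_def)
  next
    case (step n)
    have "int (multiplicity p (\<kappa> (Suc n))) - int \<mu> * int CARD('l) ^ Suc n
        = int (multiplicity p (\<kappa> n)) - int \<mu> * int CARD('l) ^ n"
      using step.hyps \<open>n0 \<ge> 1\<close> by (intro multiplicity_\<kappa>_Suc[OF _ \<zeta>] slope) auto
    with step.IH show ?case by simp
  qed
  thus thesis using that[of \<nu>] by (simp add: algebra_simps)
qed

end

theorem theorem2p1:
  fixes l p :: nat
    and G :: "('v, 'e) multigraph"
    and vs :: "'v list"
    and S :: "'e set"
    and \<alpha> :: "'e \<Rightarrow> 'l::prime_card padic_int"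
    and v_p :: "'p::prime_card padic_ac \<Rightarrow> ereal"
    and \<zeta> :: "nat \<Rightarrow> 'p padic_ac"
    and K_inf m_inf :: "'p padic_ac set"
    and \<kappa> :: "nat \<Rightarrow> nat"
    and f :: "('l, int) gen_poly"
  assumes "l = CARD('l)" and "p = CARD('p)" and "l \<noteq> p"
    and "finite_multigraph G" and "connected_multigraph G"
    and "\<forall>v\<in>verts G. valency G v \<noteq> 1"
    and "euler_char G \<noteq> 0"
    and "distinct vs" and "set vs = verts G"
    and "is_orientation G S"
    and "\<forall>n\<ge>1. connected_multigraph (tower_layer G S \<alpha> n)"
    and "\<forall>n. \<kappa> n = card (spanning_trees (tower_layer G S \<alpha> n))"
    and "f = det (voltage_matrix G vs S \<alpha>)"
    and "valuation v_p" and "extends_padic_ord v_p"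
    and "compatible_primitive_roots l \<zeta>"
    and "K_inf = padic_cyclotomic_union \<zeta>"
    and "m_inf = maximal_ideal_on v_p K_inf"
  shows "\<exists>(\<mu>::nat) g.
    gp_mu p f = enat \<mu> \<and> f = of_nat (p ^ \<mu>) * g \<and> gp_mu p g = 0 \<and>
    (let nonvanishing_from = (\<lambda>n. \<forall>i\<ge>n. \<forall>\<xi>\<in>K_inf.
           primitive_root_of_unity (l ^ i) \<xi> \<longrightarrow> gp_eval g \<xi> \<notin> m_inf)
     in \<exists>n0. 0 < n0 \<and> nonvanishing_from n0 \<and> (\<forall>m. 0 < m \<and> nonvanishing_from m \<longrightarrow> n0 \<le> m) \<and>
       (\<exists>\<nu>::int. \<forall>n\<ge>n0. int (multiplicity p (\<kappa> n)) = int \<mu> * int l ^ n + \<nu>))"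
proof -
  interpret tower: connected_tower G S v_p p vs \<alpha>
    using assms extends_padic_ord_card by unfold_locales (auto simp: prime_card)
  have \<zeta>: "primitive_root_of_unity (CARD('l) ^ i) (\<zeta> i)" for i
    using assms(1,16) by (simp add: compatible_primitive_roots_def)
  have f: "f = tower.f" and \<kappa>: "\<kappa> = tower.\<kappa>"
    using assms(12,13) by (auto simp: tower.f_def tower.\<kappa>_def)
  have "f \<noteq> 0" unfolding f using \<zeta>[of 1] by (intro tower.f_neq_0) simp
  then obtain \<mu> g where g: "gp_mu p f = enat \<mu>" "f = of_nat (p ^ \<mu>) * g" "gp_mu p g = 0"
    using gp_mu_decomposition[OF tower.prime_p] by blast
  define nonvanishing_from where "nonvanishing_from = (\<lambda>n. \<forall>i\<ge>n. \<forall>\<xi>\<in>K_inf.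
    primitive_root_of_unity (l ^ i) \<xi> \<longrightarrow> gp_eval g \<xi> \<notin> m_inf)"
  have "\<exists>n. 0 < n \<and> nonvanishing_from n"
    unfolding nonvanishing_from_def assms(1,17,18)
    using tower.ex_gp_eval_notin_maximal_ideal_from[OF tower.distinct_primes g(3)] by blast
  then obtain n0 where n0: "0 < n0" "nonvanishing_from n0"
    and minimal: "\<forall>m. 0 < m \<and> nonvanishing_from m \<longrightarrow> n0 \<le> m"
    by (subst (asm) exists_least_iff) (auto simp: not_less[symmetric])
  have "\<not> 0 < v_p (gp_eval g (\<zeta> i ^ t))" if "n0 \<le> i" "coprime t (CARD('l) ^ i)" for i t
    using n0(2) that(1) unfolding nonvanishing_from_def assms(1,17,18)
    by (intro gp_eval_root_power_not_pos[where N = "CARD('l) ^ i"] \<zeta> that(2)) simp_all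
  then obtain \<nu> where "\<And>n. n \<ge> n0 \<Longrightarrow> int (multiplicity p (\<kappa> n)) = int \<mu> * int l ^ n + \<nu>"
    using tower.multiplicity_\<kappa>[of n0 \<zeta> \<mu> g] \<zeta> g(2) n0(1) unfolding f \<kappa> assms(1) by auto
  thus ?thesis using g n0 minimal unfolding Let_def nonvanishing_from_def by blast
qed

end
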